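(* Let $h\in\mathbb{C}\setminus\{0\}$ and let $I_2\in\mathbb{C}$ be a constant. Let $\psi$ be the 3-dimensional rational map $(x_0,x_1,x_2)\mapsto(\overline{x_0},\overline{x_1},\overline{x_2})$ given by \begin{align*} \overline{x_0}&=x_2,\\ \overline{x_1}&=\frac{I_2-(x_0^2+x_0x_2+x_2^2)-2h(x_0-x_0x_1+x_2)-hx_1x_2(2x_0+x_2-1+h)}{h(-x_0+hx_0+x_0^2-2x_2+2x_0x_2)},\\ \overline{x_2}&=-x_2-x_0+\frac{hx_2}{1-x_2}. \end{align*} Then the degree of $\psi^n$ grows quadratically with respect to $n$.
   Context: The degree of $\psi^n$ refers to the degree, with respect to $x_0,x_1,x_2$, of the rational functions that are the components of the $n$-th iterate $\psi^n$ (the maximum over components of the degrees of numerator and denominator in lowest terms); "grows quadratically" means growth of exact order $n^2$ as $n\to\infty$. Background on $\psi$: it is the restriction of the 4-dimensional birational map $\varphi:\ \overline{x_0}=x_2,\ \overline{x_1}=x_3,\ \overline{x_2}=-x_2-x_0+\frac{hx_2}{1-x_2},\ \overline{x_3}=-x_1-x_3+\frac{2-x_2+hx_3}{(1-x_2)^2}$ to a level set of its invariant $$2hx_0+x_0^2-2hx_0x_1+2hx_2+x_0x_2-hx_1x_2+h^2x_1x_2+2hx_0x_1x_2+x_2^2+hx_1x_2^2-hx_0x_3+h^2x_0x_3+hx_0^2x_3-2hx_2x_3+2hx_0x_2x_3=I_2,$$ where $x_3$ is eliminated by solving this equation, which is linear in $x_3$. *)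

theory Defs
  imports
    "HOL-Computational_Algebra.Computational_Algebra"
    "HOL-Computational_Algebra.Field_as_Ring"
    "HOL-Library.Landau_Symbols"
begin

type_synonym poly3 = "complex poly poly poly"
type_synonym ratfun3 = "poly3 fract"

text \<open>
  Polynomials in three variables are iterated univariate polynomials: in \<open>p :: poly3\<close> the
  innermost polynomials are in \<open>x\<^sub>0\<close>, the middle ones in \<open>x\<^sub>1\<close> and the outermost one in \<open>x\<^sub>2\<close>, so
  that \<open>coeff (coeff (coeff p k) j) i\<close> is the coefficient of \<open>x\<^sub>0^i x\<^sub>1^j x\<^sub>2^k\<close>.
\<close>

definition const3 :: "complex \<Rightarrow> ratfun3" where
  "const3 c = to_fract [:[:[:c:]:]:]"

definition X0 :: ratfun3 where "X0 = to_fract [:[:[:0, 1:]:]:]"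
definition X1 :: ratfun3 where "X1 = to_fract [:[:0, 1:]:]"
definition X2 :: ratfun3 where "X2 = to_fract [:0, 1:]"

definition total_degree :: "poly3 \<Rightarrow> nat" where
  "total_degree p =
     Max (insert 0 {i + j + k | i j k. coeff (coeff (coeff p k) j) i \<noteq> 0})"

text \<open>\<^const>\<open>quot_of_fract\<close> yields numerator and denominator in lowest terms.\<close>

definition numer3 :: "ratfun3 \<Rightarrow> poly3" where "numer3 f = fst (quot_of_fract f)"
definition denom3 :: "ratfun3 \<Rightarrow> poly3" where "denom3 f = snd (quot_of_fract f)"

definition ratfun_degree :: "ratfun3 \<Rightarrow> nat" where
  "ratfun_degree f = max (total_degree (numer3 f)) (total_degree (denom3 f))"

text \<open>A rational self-map of affine 3-space is the triple of its component functions.\<close>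

type_synonym ratmap3 = "ratfun3 \<times> ratfun3 \<times> ratfun3"

fun ratmap_degree :: "ratmap3 \<Rightarrow> nat" where
  "ratmap_degree (f0, f1, f2) =
     Max {ratfun_degree f0, ratfun_degree f1, ratfun_degree f2}"

fun eval3 :: "poly3 \<Rightarrow> ratmap3 \<Rightarrow> ratfun3" where
  "eval3 p (g0, g1, g2) =
     poly (map_poly (\<lambda>q. poly (map_poly (\<lambda>r. poly (map_poly const3 r) g0) q) g1) p) g2"

text \<open>
  The substitution \<open>f(g\<^sub>0, g\<^sub>1, g\<^sub>2)\<close> makes sense only if the denominator of \<open>f\<close> does not become
  the zero rational function; otherwise \<open>subst3\<close> returns the junk value \<open>0\<close>.
\<close>

definition substitutable :: "ratfun3 \<Rightarrow> ratmap3 \<Rightarrow> bool" where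
  "substitutable f g \<longleftrightarrow> eval3 (denom3 f) g \<noteq> 0"

definition subst3 :: "ratfun3 \<Rightarrow> ratmap3 \<Rightarrow> ratfun3" where
  "subst3 f g = eval3 (numer3 f) g / eval3 (denom3 f) g"

fun composable :: "ratmap3 \<Rightarrow> ratmap3 \<Rightarrow> bool" where
  "composable (f0, f1, f2) g \<longleftrightarrow> substitutable f0 g \<and> substitutable f1 g \<and> substitutable f2 g"

fun ratmap_comp :: "ratmap3 \<Rightarrow> ratmap3 \<Rightarrow> ratmap3" where
  "ratmap_comp (f0, f1, f2) g = (subst3 f0 g, subst3 f1 g, subst3 f2 g)"

fun ratmap_iterate :: "ratmap3 \<Rightarrow> nat \<Rightarrow> ratmap3" where
  "ratmap_iterate f 0 = (X0, X1, X2)"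
| "ratmap_iterate f (Suc n) = ratmap_comp f (ratmap_iterate f n)"

definition psi :: "complex \<Rightarrow> complex \<Rightarrow> ratmap3" where
  "psi h I2 =
    (let c = const3 h in
      (X2,
       (const3 I2 - (X0^2 + X0 * X2 + X2^2) - 2 * c * (X0 - X0 * X1 + X2)
          - c * X1 * X2 * (2 * X0 + X2 - 1 + c))
         / (c * (- X0 + c * X0 + X0^2 - 2 * X2 + 2 * X0 * X2)),
       - X2 - X0 + c * X2 / (1 - X2)))"

end

theory Submission
  imports Defs
begin

text \<open>
  The substitution \<open>u\<^sub>n = 1 - x\<^sub>n\<close> turns the recurrence of the first component into the autonomous discrete Painleve
  equation \<open>u\<^sub>n\<^sub>+\<^sub>1 + u\<^sub>n + u\<^sub>n\<^sub>-\<^sub>1 = c - b / u\<^sub>n\<close> with \<open>c = 3 + h\<close>, \<open>b = h\<close>. It conserves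
  \<open>K = u v (u + v - c) + b (u + v)\<close>, and therefore \<open>u\<^sub>n\<^sub>+\<^sub>1 u\<^sub>n u\<^sub>n\<^sub>-\<^sub>1 = b u\<^sub>n - K\<close>, which is solved by
  \<open>u\<^sub>n = s\<^sub>n\<^sub>+\<^sub>4 s\<^sub>n\<^sub>+\<^sub>1 / (s\<^sub>n\<^sub>+\<^sub>3 s\<^sub>n\<^sub>+\<^sub>2)\<close> for the Somos-5 sequence
  \<open>s\<^sub>n\<^sub>+\<^sub>5 s\<^sub>n = b s\<^sub>n\<^sub>+\<^sub>4 s\<^sub>n\<^sub>+\<^sub>1 - K s\<^sub>n\<^sub>+\<^sub>3 s\<^sub>n\<^sub>+\<^sub>2\<close>. By the Laurent phenomenon the \<open>s\<^sub>n\<close> are polynomials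
  in \<open>u\<^sub>0, u\<^sub>1\<close>; neighbouring ones are coprime, and the degree of \<open>s\<^sub>n\<close> is the integer part of \<open>(n - 3)\<^sup>2 / 4\<close>. This gives
  the degree of the first and third components.

  The second component satisfies, up to an affine change of variable, the linearised recurrence, so it is the derivative
  of \<open>u\<^sub>n\<close> with respect to the initial values and \<open>c\<close>. Differentiating the quotient of polynomials
  \<open>s\<^sub>n\<close> at most doubles the degree, up to a constant, although the second component accumulates a sum of
  \<open>n\<close> terms of quadratic degree.
\<close>

subsection \<open>Substitution into iterated polynomials\<close>

definition is_hom :: "('a::comm_ring_1 \<Rightarrow> 'b::comm_ring_1) \<Rightarrow> bool" where
  "is_hom f \<longleftrightarrow> f 1 = 1 \<and> (\<forall>x y. f (x + y) = f x + f y) \<and> (\<forall>x y. f (x * y) = f x * f y)"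

lemma is_hom_one: "is_hom f \<Longrightarrow> f 1 = 1"
  and is_hom_add: "is_hom f \<Longrightarrow> f (x + y) = f x + f y"
  and is_hom_mult: "is_hom f \<Longrightarrow> f (x * y) = f x * f y"
  by (auto simp: is_hom_def)

lemma is_hom_zero: "is_hom f \<Longrightarrow> f 0 = 0"
  using is_hom_add[of f 0 0] by simp

lemma is_hom_uminus: "is_hom f \<Longrightarrow> f (- x) = - f x"
  using is_hom_add[of f x "- x"] is_hom_zero[of f] by (simp add: minus_unique)

lemma is_hom_diff: "is_hom f \<Longrightarrow> f (x - y) = f x - f y"
  using is_hom_add[of f x "- y"] is_hom_uminus[of f y] by simp

lemma is_hom_power: "is_hom f \<Longrightarrow> f (x ^ n) = f x ^ n"
  by (induction n) (simp_all add: is_hom_one is_hom_mult)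

lemma is_hom_of_nat: "is_hom f \<Longrightarrow> f (of_nat n) = of_nat n"
  by (induction n) (simp_all add: is_hom_zero is_hom_one is_hom_add)

lemma is_hom_numeral: "is_hom f \<Longrightarrow> f (numeral n) = numeral n"
  using is_hom_of_nat[of f "numeral n"] by simp

lemmas is_hom_simps = is_hom_zero is_hom_one is_hom_add is_hom_mult is_hom_uminus is_hom_diff
  is_hom_power is_hom_numeral

definition peval :: "('a::comm_ring_1 \<Rightarrow> 'b::comm_ring_1) \<Rightarrow> 'b \<Rightarrow> 'a poly \<Rightarrow> 'b" where
  "peval f x p = poly (map_poly f p) x"

lemma peval_0 [simp]: "peval f x 0 = 0"
  by (simp add: peval_def)

lemma peval_pCons: "is_hom f \<Longrightarrow> peval f x (pCons a p) = f a + x * peval f x p"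
  by (simp add: peval_def map_poly_pCons is_hom_zero)

lemma is_hom_peval:
  assumes "is_hom f"
  shows "is_hom (peval f x)"
proof -
  note h = assms is_hom_simps[OF assms] peval_pCons[OF assms]
  have 1: "peval f x 1 = 1"
    by (simp add: one_pCons h)
  have add: "peval f x (p + q) = peval f x p + peval f x q" for p q
    by (induction p q rule: poly_induct2) (simp_all add: h algebra_simps)
  have smult: "peval f x (smult a p) = f a * peval f x p" for a p
    by (induction p) (simp_all add: h algebra_simps)
  have "peval f x (p * q) = peval f x p * peval f x q" for p q
    by (induction p) (simp_all add: h add smult algebra_simps)
  with 1 add show ?thesis
    by (simp add: is_hom_def)
qed

definition px0 :: poly3 where "px0 = [:[:[:0, 1:]:]:]"
definition px1 :: poly3 where "px1 = [:[:0, 1:]:]"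
definition px2 :: poly3 where "px2 = [:0, 1:]"
definition pc :: "complex \<Rightarrow> poly3" where "pc k = [:[:[:k:]:]:]"

text \<open>The target ring is left arbitrary, so that a single evaluation map covers substitution
  of rational functions (\<open>eval3\<close>), homogenisation (\<open>homog\<close>) and
  deformation (\<open>jet\<close>).\<close>

definition ev3 :: "(complex \<Rightarrow> 'r::comm_ring_1) \<Rightarrow> 'r \<Rightarrow> 'r \<Rightarrow> 'r \<Rightarrow> poly3 \<Rightarrow> 'r" where
  "ev3 k a b c = peval (peval (peval k a) b) c"

lemma is_hom_ev3: "is_hom k \<Longrightarrow> is_hom (ev3 k a b c)"
  by (simp add: ev3_def is_hom_peval)

lemma ev3_gens:
  assumes "is_hom k"
  shows "ev3 k a b c px0 = a" "ev3 k a b c px1 = b" "ev3 k a b c px2 = c" "ev3 k a b c (pc z) = k z"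
  using assms by (simp_all add: ev3_def px0_def px1_def px2_def pc_def peval_pCons is_hom_peval is_hom_simps)

lemma is_hom_pc: "is_hom pc"
  by (simp add: is_hom_def pc_def one_pCons)

lemma is_hom_to_fract: "is_hom to_fract"
  by (simp add: is_hom_def)

lemma is_hom_comp: "is_hom f \<Longrightarrow> is_hom g \<Longrightarrow> is_hom (\<lambda>x. f (g x))"
  by (simp add: is_hom_def)

lemma is_hom_const_poly: "is_hom (\<lambda>x. [:x:])"
  by (simp add: is_hom_def one_pCons)

lemma const3_eq: "const3 k = to_fract (pc k)"
  by (simp add: const3_def pc_def)

lemma is_hom_const3: "is_hom const3"
  unfolding const3_eq[abs_def] by (rule is_hom_comp[OF is_hom_to_fract is_hom_pc])

lemma X_eq: "X0 = to_fract px0" "X1 = to_fract px1" "X2 = to_fract px2"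
  by (simp_all add: X0_def X1_def X2_def px0_def px1_def px2_def)

lemma eval3_eq: "eval3 p (g0, g1, g2) = ev3 const3 g0 g1 g2 p"
  by (simp add: ev3_def peval_def[abs_def])

lemma is_hom_eval3: "is_hom (\<lambda>p. eval3 p g)"
  by (cases g) (simp only: eval3_eq is_hom_ev3[OF is_hom_const3])

section \<open>Fractions in lowest terms\<close>

lemma quot_cross:
  fixes f :: ratfun3
  assumes "f = to_fract P / to_fract Q" "Q \<noteq> 0"
  shows "P * denom3 f = numer3 f * Q" "numer3 f dvd P" "denom3 f dvd Q"
proof -
  have d: "denom3 f \<noteq> 0" and cop: "coprime (numer3 f) (denom3 f)"
    by (simp_all add: denom3_def numer3_def coprime_quot_of_fract)
  have "f = to_fract (numer3 f) / to_fract (denom3 f)"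
    by (simp add: denom3_def numer3_def quot_to_fract_def flip: Fract_conv_to_fract)
  with assms(1) have "to_fract P / to_fract Q = to_fract (numer3 f) / to_fract (denom3 f)"
    by simp
  with assms(2) d have "to_fract (P * denom3 f) = to_fract (numer3 f * Q)"
    by (simp add: frac_eq_eq)
  then show *: "P * denom3 f = numer3 f * Q"
    by (simp only: to_fract_eq_iff)
  show "numer3 f dvd P"
    using cop * by (metis coprime_dvd_mult_left_iff dvd_triv_left)
  show "denom3 f dvd Q"
    using cop * by (metis coprime_commute coprime_dvd_mult_right_iff dvd_triv_right)
qed

text \<open>The reduced denominator divides \<open>Q\<close>, so it survives the substitution
  whenever \<open>Q\<close> does. Hence substitution may be computed from any representation, with
  no reduction to lowest terms.\<close>

lemma subst3_quotient:
  assumes "f = to_fract P / to_fract Q" "eval3 Q g \<noteq> 0"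
  shows "substitutable f g \<and> subst3 f g = eval3 P g / eval3 Q g"
proof -
  note h = is_hom_simps[OF is_hom_eval3[of g]]
  have Q: "Q \<noteq> 0"
    using assms(2) h(1) by auto
  note c = quot_cross[OF assms(1) Q]
  have e: "eval3 P g * eval3 (denom3 f) g = eval3 (numer3 f) g * eval3 Q g"
    using arg_cong[OF c(1), of "\<lambda>p. eval3 p g"] by (simp only: h)
  obtain R where "Q = denom3 f * R"
    using c(3) by (auto simp: dvd_def)
  then have "eval3 Q g = eval3 (denom3 f) g * eval3 R g"
    by (simp only: h)
  with assms(2) have "eval3 (denom3 f) g \<noteq> 0"
    by auto
  with e assms(2) show ?thesis
    by (simp add: substitutable_def subst3_def field_simps)
qed

section \<open>Total degree as a univariate degree\<close>

text \<open>
  Multiplying each variable by a new variable \<open>s\<close> turns the total degree into the degree in \<open>s\<close>,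
  which is additive on products.
\<close>

definition homog :: "poly3 \<Rightarrow> poly3 poly" where
  "homog = ev3 (\<lambda>k. [:pc k:]) [:0, px0:] [:0, px1:] [:0, px2:]"

lemma is_hom_homog: "is_hom homog"
  unfolding homog_def by (intro is_hom_ev3 is_hom_comp[OF is_hom_const_poly is_hom_pc])

lemma coeff_homog:
  "coeff (coeff (coeff (coeff (homog p) d) k) j) i =
    (if d = i + j + k then coeff (coeff (coeff p k) j) i else 0)"
proof -
  have k: "is_hom (\<lambda>k. [:pc k:])"
    by (intro is_hom_comp[OF is_hom_const_poly is_hom_pc])
  \<comment> \<open>\<open>e0\<close> and \<open>e1\<close> are the restrictions of
    \<open>homog\<close> to polynomials in the first variable and in the first two; the coefficient
    formula is proved for one more variable at a time.\<close>
  define e0 where "e0 = peval (\<lambda>k. [:pc k:]) [:0, px0:]"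
  define e1 where "e1 = peval e0 [:0, px1:]"
  have h0: "is_hom e0" and h1: "is_hom e1"
    by (simp_all add: e0_def e1_def k is_hom_peval)
  have hom: "homog = peval e1 [:0, px2:]"
    by (simp add: homog_def ev3_def e0_def e1_def)
  have mul0: "coeff (coeff (coeff (px0 * q) k) j) i =
      (case i of 0 \<Rightarrow> 0 | Suc i \<Rightarrow> coeff (coeff (coeff q k) j) i)" for q k j i
    by (simp add: px0_def coeff_pCons split: nat.split)
  have mul1: "coeff (coeff (coeff (px1 * q) k) j) i =
      (case j of 0 \<Rightarrow> 0 | Suc j \<Rightarrow> coeff (coeff (coeff q k) j) i)" for q k j i
    by (simp add: px1_def coeff_pCons split: nat.split)
  have mul2: "coeff (coeff (coeff (px2 * q) k) j) i =
      (case k of 0 \<Rightarrow> 0 | Suc k \<Rightarrow> coeff (coeff (coeff q k) j) i)" for q k j i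
    by (simp add: px2_def coeff_pCons split: nat.split)
  have mul: "coeff ([:0, x:] * q) d = (case d of 0 \<Rightarrow> 0 | Suc d \<Rightarrow> x * coeff q d)" for x :: poly3 and q d
    by (simp add: coeff_pCons split: nat.split)
  have c0: "coeff (coeff (coeff (coeff (e0 p) d) k) j) i =
      (if k = 0 \<and> j = 0 \<and> d = i then coeff p i else 0)" for p d k j i
  proof (induction p arbitrary: d i)
    case 0
    then show ?case by (simp add: e0_def)
  next
    case (pCons a p)
    have "e0 (pCons a p) = [:pc a:] + [:0, px0:] * e0 p"
      by (simp add: e0_def peval_pCons k)
    then show ?case
      using pCons.IH by (auto simp: mul mul0 pc_def coeff_pCons split: nat.split)
  qed
  have c1: "coeff (coeff (coeff (coeff (e1 p) d) k) j) i =
      (if k = 0 \<and> d = i + j then coeff (coeff p j) i else 0)" for p d k j i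
  proof (induction p arbitrary: d j)
    case 0
    then show ?case by (simp add: e1_def)
  next
    case (pCons a p)
    have "e1 (pCons a p) = e0 a + [:0, px1:] * e1 p"
      by (simp add: e1_def peval_pCons h0)
    then show ?case
      using pCons.IH by (auto simp: mul mul1 c0 coeff_pCons split: nat.split)
  qed
  show ?thesis
  proof (induction p arbitrary: d k)
    case 0
    then show ?case by (simp add: hom)
  next
    case (pCons a p)
    have "homog (pCons a p) = e1 a + [:0, px2:] * homog p"
      by (simp add: hom peval_pCons h1)
    then show ?case
      using pCons.IH by (auto simp: mul mul2 c1 coeff_pCons split: nat.split)
  qed
qed

lemma homog_eq_0_iff: "homog p = 0 \<longleftrightarrow> p = 0"
proof
  assume "homog p = 0"
  then have "coeff (coeff (coeff p k) j) i = 0" for i j k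
    using coeff_homog[of p "i + j + k" k j i] by simp
  then show "p = 0"
    by (auto simp: poly_eq_iff)
qed (simp add: is_hom_zero[OF is_hom_homog])

lemma total_degree_eq: "total_degree p = degree (homog p)"
proof -
  have 1: "{i + j + k | i j k. coeff (coeff (coeff p k) j) i \<noteq> 0} = {d. coeff (homog p) d \<noteq> 0}"
    (is "?A = ?B")
  proof (intro equalityI subsetI)
    fix d assume "d \<in> ?B"
    then obtain i j k where "coeff (coeff (coeff (coeff (homog p) d) k) j) i \<noteq> 0"
      by (auto simp: poly_eq_iff)
    then show "d \<in> ?A"
      by (auto simp: coeff_homog split: if_splits)
  next
    fix d assume "d \<in> ?A"
    then obtain i j k where d: "d = i + j + k" "coeff (coeff (coeff p k) j) i \<noteq> 0"
      by auto
    then have "coeff (coeff (coeff (coeff (homog p) d) k) j) i \<noteq> 0"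
      by (simp add: coeff_homog)
    then have "coeff (homog p) d \<noteq> 0"
      by (intro notI) simp
    then show "d \<in> ?B"
      by simp
  qed
  have "Max (insert 0 ?B) = degree (homog p)"
  proof (rule Max_eqI)
    show "finite (insert 0 ?B)"
      using finite_subset[of ?B "{..degree (homog p)}"] by (auto intro: le_degree)
    show "degree (homog p) \<in> insert 0 ?B"
      by (cases "homog p = 0") auto
  qed (auto intro: le_degree)
  then show ?thesis
    unfolding total_degree_def 1 .
qed

lemma total_degree_mult:
  assumes "p \<noteq> 0" "q \<noteq> 0"
  shows "total_degree (p * q) = total_degree p + total_degree q"
  using assms by (simp add: total_degree_eq is_hom_mult[OF is_hom_homog] degree_mult_eq homog_eq_0_iff)

lemma total_degree_mult_le: "total_degree (p * q) \<le> total_degree p + total_degree q"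
  by (simp add: total_degree_eq is_hom_mult[OF is_hom_homog] degree_mult_le)

lemma total_degree_add_le: "total_degree (p + q) \<le> max (total_degree p) (total_degree q)"
  by (simp add: total_degree_eq is_hom_add[OF is_hom_homog] degree_add_le_max)

lemma total_degree_diff_le: "total_degree (p - q) \<le> max (total_degree p) (total_degree q)"
  by (simp add: total_degree_eq is_hom_diff[OF is_hom_homog] degree_diff_le_max)

lemma total_degree_dvd_le:
  assumes "p dvd q" "q \<noteq> 0"
  shows "total_degree p \<le> total_degree q"
  using assms by (auto simp: dvd_def total_degree_mult)

lemma total_degree_0 [simp]: "total_degree 0 = 0"
  by (simp add: total_degree_eq is_hom_zero[OF is_hom_homog])

lemma total_degree_gens:
  "total_degree px0 = 1" "total_degree px1 = 1" "total_degree px2 = 1" "total_degree (pc k) = 0"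
  "total_degree 1 = 0" "total_degree (numeral n) = 0" "total_degree (- p) = total_degree p"
proof -
  have k: "is_hom (\<lambda>k. [:pc k:])"
    by (intro is_hom_comp[OF is_hom_const_poly is_hom_pc])
  show "total_degree px0 = 1" "total_degree px1 = 1" "total_degree px2 = 1" "total_degree (pc k) = 0"
    unfolding total_degree_eq homog_def ev3_gens[OF k] by (simp_all add: px0_def px1_def px2_def)
qed (simp_all add: total_degree_eq is_hom_simps[OF is_hom_homog])

lemma ratfun_degree_le:
  fixes f :: ratfun3
  assumes "f = to_fract P / to_fract Q" "Q \<noteq> 0" "total_degree P \<le> d" "total_degree Q \<le> d"
  shows "ratfun_degree f \<le> d"
proof -
  note c = quot_cross[OF assms(1,2)]
  have "total_degree (numer3 f) \<le> d"
  proof (cases "P = 0")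
    case True
    with c(1) assms(2) show ?thesis by simp
  next
    case False
    then show ?thesis
      using total_degree_dvd_le[OF c(2)] assms(3) by simp
  qed
  moreover have "total_degree (denom3 f) \<le> d"
    using total_degree_dvd_le[OF c(3) assms(2)] assms(4) by simp
  ultimately show ?thesis
    by (simp add: ratfun_degree_def)
qed

text \<open>Nothing cancels in a coprime representation: the cross-multiplied identity forces
  \<open>Q\<close> to divide the reduced denominator.\<close>

lemma ratfun_degree_ge:
  fixes f :: ratfun3
  assumes "f = to_fract P / to_fract Q" "Q \<noteq> 0" "coprime P Q"
  shows "ratfun_degree f \<ge> total_degree Q"
proof -
  note c = quot_cross[OF assms(1,2)]
  have "Q dvd denom3 f"
    using assms(3) c(1) by (metis coprime_commute coprime_dvd_mult_right_iff dvd_triv_right)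
  moreover have "denom3 f \<noteq> 0"
    by (simp add: denom3_def)
  ultimately have "total_degree Q \<le> total_degree (denom3 f)"
    by (rule total_degree_dvd_le)
  then show ?thesis
    by (simp add: ratfun_degree_def)
qed

subsection \<open>Somos-5 sequences\<close>

definition dp1_inv :: "'a \<Rightarrow> 'a \<Rightarrow> 'a \<Rightarrow> 'a \<Rightarrow> 'a::comm_ring_1" where
  "dp1_inv b c u v = u * v * (u + v - c) + b * (u + v)"

text \<open>
  The initial values make the first quotient \<open>s\<^sub>4 s\<^sub>1 / (s\<^sub>3 s\<^sub>2)\<close> equal to \<open>u\<close> and the second one,
  \<open>s\<^sub>5 s\<^sub>2 / (s\<^sub>4 s\<^sub>3)\<close>, equal to \<open>v\<close>. The division is exact (\<open>somos5_rec\<close>).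
\<close>

fun somos5 :: "'a \<Rightarrow> 'a \<Rightarrow> 'a \<Rightarrow> 'a \<Rightarrow> nat \<Rightarrow> 'a::{ring_gcd, idom_divide}" where
  "somos5 b c u v 0 = u * (c - u - v) - b"
| "somos5 b c u v (Suc 0) = u"
| "somos5 b c u v (Suc (Suc 0)) = 1"
| "somos5 b c u v (Suc (Suc (Suc 0))) = 1"
| "somos5 b c u v (Suc (Suc (Suc (Suc 0)))) = 1"
| "somos5 b c u v (Suc (Suc (Suc (Suc (Suc n))))) =
    (b * somos5 b c u v (Suc (Suc (Suc (Suc n)))) * somos5 b c u v (Suc n)
      - dp1_inv b c u v * somos5 b c u v (Suc (Suc (Suc n))) * somos5 b c u v (Suc (Suc n)))
    div somos5 b c u v n"

declare somos5.simps(6) [simp del]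

text \<open>The Laurent phenomenon in one step. Modulo \<open>a0\<close>, the first three relations
  give \<open>e * am3 * am4 = 0\<close>, and the last two turn the claimed multiple, times
  \<open>am1 * am2\<close>, into \<open>- b * K * a2 * e\<close>. Coprimality cancels the extra
  factors.\<close>

lemma somos5_dvd:
  fixes a0 :: "'a::ring_gcd"
  assumes r: "a0 * z = b * am1 * am4 - K * am2 * am3"
    "a1 * am4 = b * a0 * am3 - K * am1 * am2"
    "a2 * am3 = b * a1 * am2 - K * a0 * am1"
    "a3 * am2 = b * a2 * am1 - K * a1 * a0"
    "a4 * am1 = b * a3 * a0 - K * a2 * a1"
    and c: "coprime a0 am1" "coprime a0 am2" "coprime a0 am3" "coprime a0 am4"
  shows "a0 dvd b * a4 * a1 - K * a3 * a2"
proof -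
  define e where "e = a1\<^sup>2 * am2 + a2 * am1\<^sup>2"
  have "e * am3 * am4 = a1 * am2 * am3 * (a1 * am4) + am1\<^sup>2 * am4 * (a2 * am3)"
    by (simp add: e_def algebra_simps power2_eq_square)
  also have "\<dots> = a0 * (b * a1 * am2 * am3\<^sup>2 - K * am1 ^ 3 * am4)
      + a1 * am1 * am2 * (b * am1 * am4 - K * am2 * am3)"
    unfolding r(2,3) by (simp add: algebra_simps power2_eq_square power3_eq_cube)
  also have "\<dots> = a0 * (b * a1 * am2 * am3\<^sup>2 - K * am1 ^ 3 * am4 + a1 * am1 * am2 * z)"
    unfolding r(1)[symmetric] by (simp add: algebra_simps)
  finally have "a0 dvd e * am3 * am4"
    by simp
  then have e: "a0 dvd e"
    using c by (simp add: coprime_dvd_mult_left_iff)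
  have "(b * a4 * a1 - K * a3 * a2) * am1 * am2 = b * a1 * am2 * (a4 * am1) - K * a2 * am1 * (a3 * am2)"
    by (simp add: algebra_simps)
  also have "\<dots> = a0 * (b\<^sup>2 * a1 * am2 * a3 + K\<^sup>2 * a1 * a2 * am1) - b * K * a2 * e"
    unfolding r(4,5) e_def by (simp add: algebra_simps power2_eq_square)
  finally have "a0 dvd (b * a4 * a1 - K * a3 * a2) * am1 * am2"
    using e by simp
  then show ?thesis
    using c by (simp add: coprime_dvd_mult_left_iff)
qed

text \<open>Exact division and coprimality need each other, hence one joint induction. A new term is
  coprime to each of its four predecessors because such a predecessor divides one of the two
  products in the recurrence and is coprime to the other; for this \<open>K\<close> has to be
  coprime to all terms too.\<close>

lemma somos5_properties:
  fixes b c u v :: "'a::{ring_gcd, idom_divide}"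
  assumes "is_unit b" "coprime u v"
  defines "s \<equiv> somos5 b c u v" and "K \<equiv> dp1_inv b c u v"
  shows somos5_rec: "s (n + 5) * s n = b * s (n + 4) * s (n + 1) - K * s (n + 3) * s (n + 2)"
    and somos5_coprime: "j \<in> {1..4} \<Longrightarrow> coprime (s (n + j)) (s n)"
proof -
  have s: "s 0 = u * (c - u - v) - b" "s 1 = u" "s (Suc 0) = u" "s 2 = 1"
    "s (Suc (Suc 0)) = 1" "s (Suc (Suc (Suc 0))) = 1" "s 3 = 1" "s 4 = 1"
    by (simp_all add: s_def eval_nat_numeral)
  have step: "s (n + 5) = (b * s (n + 4) * s (n + 1) - K * s (n + 3) * s (n + 2)) div s n" for n
    by (simp add: s_def K_def eval_nat_numeral somos5.simps(6))
  \<comment> \<open>Modulo \<open>s 0\<close>, \<open>K\<close> is \<open>b * u\<close>; modulo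
    \<open>u\<close>, it is \<open>b * v\<close>. This gives the coprimality of \<open>K\<close>
    with the initial terms, and \<open>K0\<close> also yields \<open>s 5 = v\<close>.\<close>
  have K0: "K = b * u - v * s 0" and Ku: "b * v - K = u * (v * (c - u - v) - b)"
    by (simp_all add: K_def dp1_inv_def s algebra_simps)
  have b: "coprime p (b * q) \<longleftrightarrow> coprime p q" for p q
    using assms(1) by (simp add: is_unit_right_imp_coprime)
  have s0u: "coprime (s 0) u"
  proof (rule coprimeI)
    fix p assume "p dvd s 0" "p dvd u"
    then have "p dvd u * (c - u - v) - s 0"
      by simp
    then have "p dvd b"
      by (simp add: s)
    with assms(1) show "is_unit p"
      using dvd_trans by blast
  qed
  have s0K: "coprime (s 0) K"
  proof (rule coprimeI)
    fix p assume p: "p dvd s 0" "p dvd K"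
    then have "p dvd K + v * s 0"
      by simp
    then have "p dvd b * u"
      by (simp add: K0)
    with p(1) show "is_unit p"
      using s0u b by (metis coprime_common_divisor)
  qed
  have uK: "coprime u K"
  proof (rule coprimeI)
    fix p assume p: "p dvd u" "p dvd K"
    then have "p dvd K + (b * v - K)"
      using Ku by simp
    then have "p dvd b * v"
      by simp
    with p(1) show "is_unit p"
      using assms(2) b by (metis coprime_common_divisor)
  qed
  define P where "P n \<longleftrightarrow>
      (\<forall>m<n. s (m + 5) * s m = b * s (m + 4) * s (m + 1) - K * s (m + 3) * s (m + 2)) \<and>
      (\<forall>i\<le>n + 4. coprime (s i) K \<and> (\<forall>j\<in>{1..4}. i + j \<le> n + 4 \<longrightarrow> coprime (s (i + j)) (s i)))" for n
  have "P n" for n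
  proof (induction n)
    case 0
    have "coprime (s i) K \<and> (\<forall>j\<in>{1..4}. i + j \<le> 4 \<longrightarrow> coprime (s (i + j)) (s i))" if i: "i \<le> 4" for i
    proof -
      consider "i = 0" | "i = 1" | "i = 2" | "i = 3" | "i = 4"
        using i by linarith
      then show ?thesis
      proof cases
        case 1
        have "coprime (s j) (s 0)" if j: "j \<in> {1..4}" for j
        proof -
          consider "j = 1" | "j = 2" | "j = 3" | "j = 4"
            using j by force
          then show ?thesis
            using s0u by cases (simp_all add: s coprime_commute)
        qed
        with 1 s0K show ?thesis
          by simp
      next
        case 2
        have "coprime (s (1 + j)) (s 1)" if j: "j \<in> {1..3}" for j
        proof -
          consider "1 + j = 2" | "1 + j = 3" | "1 + j = 4"
            using j by force
          then show ?thesis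
            by cases (simp_all only: s coprime_1_left)
        qed
        with 2 uK show ?thesis
          by (auto simp: s)
      qed (auto simp: s coprime_commute)
    qed
    then show ?case
      by (simp add: P_def)
  next
    case (Suc n)
    then have rec: "s (m + 5) * s m = b * s (m + 4) * s (m + 1) - K * s (m + 3) * s (m + 2)"
      if "m < n" for m
      using that by (simp add: P_def)
    have cK: "coprime (s i) K" if "i \<le> n + 4" for i
      using Suc that by (simp add: P_def)
    have cop: "coprime (s (i + j)) (s i)" if "j \<in> {1..4}" "i + j \<le> n + 4" for i j
      using Suc that by (simp add: P_def)
    have v5: "s 5 = v" if "s 0 \<noteq> 0"
      using step[of 0] that K0 by (simp add: s)
    have "s n dvd b * s (n + 4) * s (n + 1) - K * s (n + 3) * s (n + 2)"
    \<comment> \<open>The divisibility argument uses the recurrence five steps back, so the first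
      five divisors are treated by hand.\<close>
    proof (cases "n < 5")
      case True
      then consider "n = 0" | "n = 1" | "n = 2" | "n = 3" | "n = 4"
        by linarith
      then show ?thesis
      proof cases
        case 1
        then show ?thesis
          using K0 by (simp add: s)
      next
        case 2
        \<comment> \<open>\<open>s 5 = v\<close> is available only for
          \<open>s 0 \<noteq> 0\<close>. If \<open>s 0 = 0\<close>, then coprimality with
          \<open>s 0\<close> makes \<open>u\<close> a unit.\<close>
        have "u dvd b * s 5 - K"
        proof (cases "s 0 = 0")
          case True
          then have "is_unit u"
            using s0u by simp
          then show ?thesis
            by (rule unit_imp_dvd)
        next
          case False
          then show ?thesis
            using v5 Ku by simp
        qed
        with 2 s show ?thesis
          by simp
      qed (simp_all add: s)
    next
      case False
      then obtain m where n: "n = m + 5"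
        by (metis add.commute le_Suc_ex not_less)
      show ?thesis
      proof (rule somos5_dvd)
        show "s n * s m = b * s (m + 4) * s (m + 1) - K * s (m + 3) * s (m + 2)"
          using rec[of m] by (simp add: n)
        show "s (n + 1) * s (m + 1) = b * s n * s (m + 2) - K * s (m + 4) * s (m + 3)"
          "s (n + 2) * s (m + 2) = b * s (n + 1) * s (m + 3) - K * s n * s (m + 4)"
          "s (n + 3) * s (m + 3) = b * s (n + 2) * s (m + 4) - K * s (n + 1) * s n"
          "s (n + 4) * s (m + 4) = b * s (n + 3) * s n - K * s (n + 2) * s (n + 1)"
          using rec[of "m + 1"] rec[of "m + 2"] rec[of "m + 3"] rec[of "m + 4"]
          by (simp_all add: n numeral_eq_Suc)
        show "coprime (s n) (s (m + 4))" "coprime (s n) (s (m + 3))"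
          "coprime (s n) (s (m + 2))" "coprime (s n) (s (m + 1))"
          using cop[of 1 "m + 4"] cop[of 2 "m + 3"] cop[of 3 "m + 2"] cop[of 4 "m + 1"]
          by (simp_all add: n numeral_eq_Suc)
      qed
    qed
    then have new: "s (n + 5) * s n = b * s (n + 4) * s (n + 1) - K * s (n + 3) * s (n + 2)"
      by (simp add: step)
    have c1: "coprime (s (n + 5)) q"
      if "coprime q (b * s (n + 4) * s (n + 1))" "q dvd K * s (n + 3) * s (n + 2)" for q
    proof (rule coprimeI)
      fix p assume p: "p dvd s (n + 5)" "p dvd q"
      then have "p dvd s (n + 5) * s n + K * s (n + 3) * s (n + 2)"
        using that(2) by (intro dvd_add) (auto intro: dvd_trans)
      then have "p dvd b * s (n + 4) * s (n + 1)"
        using new by simp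
      with that(1) p(2) show "is_unit p"
        by (metis coprime_common_divisor)
    qed
    have c2: "coprime (s (n + 5)) q"
      if "coprime q (K * s (n + 3) * s (n + 2))" "q dvd b * s (n + 4) * s (n + 1)" for q
    proof (rule coprimeI)
      fix p assume p: "p dvd s (n + 5)" "p dvd q"
      then have "p dvd b * s (n + 4) * s (n + 1) - s (n + 5) * s n"
        using that(2) by (intro dvd_diff) (auto intro: dvd_trans)
      then have "p dvd K * s (n + 3) * s (n + 2)"
        using new by simp
      with that(1) p(2) show "is_unit p"
        by (metis coprime_common_divisor)
    qed
    note cop' = cop[of 1 "n + 1"] cop[of 1 "n + 2"] cop[of 1 "n + 3"] cop[of 2 "n + 1"] cop[of 2 "n + 2"]
      cop[of 3 "n + 1"] cK[of "n + 1"] cK[of "n + 2"] cK[of "n + 3"] cK[of "n + 4"]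
    have bc: "coprime p b" "coprime b p" for p
      using assms(1) by (rule is_unit_right_imp_coprime is_unit_left_imp_coprime)+
    have "coprime (s (n + 5)) K"
      by (rule c1) (use cop' in \<open>auto simp: bc coprime_commute numeral_eq_Suc\<close>)
    moreover have "coprime (s (n + 5)) (s (n + 4))" 
      by (rule c2) (use cop' in \<open>auto simp: bc coprime_commute numeral_eq_Suc\<close>)
    moreover have "coprime (s (n + 5)) (s (n + 3))"
      by (rule c1) (use cop' in \<open>auto simp: bc coprime_commute numeral_eq_Suc\<close>)
    moreover have "coprime (s (n + 5)) (s (n + 2))"
      by (rule c1) (use cop' in \<open>auto simp: bc coprime_commute numeral_eq_Suc\<close>)
    moreover have "coprime (s (n + 5)) (s (n + 1))"
      by (rule c2) (use cop' in \<open>auto simp: bc coprime_commute numeral_eq_Suc\<close>)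
    ultimately have cn: "coprime (s (n + 5)) K" "\<And>i. i \<in> {n + 1..n + 4} \<Longrightarrow> coprime (s (n + 5)) (s i)"
      by (auto simp: atLeastAtMost_iff le_Suc_eq numeral_eq_Suc)
    have "coprime (s (i + j)) (s i)" if "i + j \<le> Suc n + 4" "j \<in> {1..4}" for i j
    proof (cases "i + j \<le> n + 4")
      case False
      with that have "i + j = n + 5" "i \<in> {n + 1..n + 4}"
        by auto
      with cn(2) show ?thesis
        by metis
    qed (use cop that in auto)
    moreover have "coprime (s i) K" if "i \<le> Suc n + 4" for i
    proof (cases "i \<le> n + 4")
      case False
      with that have "i = n + 5"
        by auto
      with cn(1) show ?thesis
        by metis
    qed (use cK in auto)
    moreover have "s (m + 5) * s m = b * s (m + 4) * s (m + 1) - K * s (m + 3) * s (m + 2)"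
      if "m < Suc n" for m
      using rec[of m] new that by (cases "m = n") auto
    ultimately show ?case
      unfolding P_def by blast
  qed
  then have P: "P (Suc n)" "P (n + j)"
    by blast+
  then show "s (n + 5) * s n = b * s (n + 4) * s (n + 1) - K * s (n + 3) * s (n + 2)"
    "j \<in> {1..4} \<Longrightarrow> coprime (s (n + j)) (s n)"
    unfolding P_def by auto
qed

section \<open>Somos quotients and the discrete Painleve equation\<close>

context
  fixes s :: "nat \<Rightarrow> 'a::field" and b c u v :: 'a
  assumes nz: "\<And>n. s n \<noteq> 0"
    and init: "s 1 = u" "s 2 = 1" "s 3 = 1" "s 4 = 1" "s 5 = v"
    and rec: "\<And>n. s (n + 5) * s n =
      b * s (n + 4) * s (n + 1) - dp1_inv b c u v * s (n + 3) * s (n + 2)"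
begin

text \<open>The triple product telescopes to a quotient whose numerator is the left side of the
  Somos recurrence at \<open>n + 1\<close>.\<close>

lemma somos_quotient_prod:
  defines "x \<equiv> \<lambda>n. s (n + 4) * s (n + 1) / (s (n + 3) * s (n + 2))"
  shows "x (n + 2) * x (n + 1) * x n = b * x (n + 1) - dp1_inv b c u v"
proof -
  have "x (n + 2) * x (n + 1) * x n = s (n + 6) * s (n + 1) / (s (n + 4) * s (n + 3))"
    using nz by (simp add: x_def field_simps numeral_eq_Suc)
  also have "s (n + 6) * s (n + 1) = b * s (n + 5) * s (n + 2) - dp1_inv b c u v * s (n + 4) * s (n + 3)"
    using rec[of "n + 1"] by (simp add: numeral_eq_Suc)
  also have "\<dots> / (s (n + 4) * s (n + 3)) = b * x (n + 1) - dp1_inv b c u v"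
    using nz by (simp add: x_def field_simps numeral_eq_Suc)
  finally show ?thesis .
qed

text \<open>Conservation and equation are proved together: where the invariant has the value
  \<open>K\<close>, the product relation yields the equation, and consecutive values of the
  invariant differ by a multiple of the equation.\<close>

lemma somos_quotient_dp1:
  defines "x \<equiv> \<lambda>n. s (n + 4) * s (n + 1) / (s (n + 3) * s (n + 2))"
  shows "x (n + 2) + x (n + 1) + x n = c - b / x (n + 1)"
proof -
  have prod: "x (n + 2) * x (n + 1) * x n = b * x (n + 1) - dp1_inv b c u v" for n
    unfolding x_def by (rule somos_quotient_prod)
  have x0: "x n \<noteq> 0" for n
    using nz by (simp add: x_def)
  have step: "x (n + 1) * (x (n + 2) + x (n + 1) + x n - c) = - b"
    if "dp1_inv b c (x n) (x (n + 1)) = dp1_inv b c u v" for n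
  proof -
    have "x n * (x (n + 1) * (x (n + 2) + x (n + 1) + x n - c) + b)
        = x (n + 2) * x (n + 1) * x n + dp1_inv b c (x n) (x (n + 1)) - b * x (n + 1)"
      by (simp add: dp1_inv_def algebra_simps)
    also have "\<dots> = 0"
      using that prod[of n] by simp
    finally show ?thesis
      using x0 by (simp add: add_eq_0_iff2)
  qed
  have "dp1_inv b c (x n) (x (n + 1)) = dp1_inv b c u v"
  proof (induction n)
    case 0
    then show ?case
      using init by (simp add: x_def numeral_eq_Suc)
  next
    case (Suc n)
    have "dp1_inv b c (x (n + 1)) (x (n + 2)) - dp1_inv b c (x n) (x (n + 1))
        = (x (n + 2) - x n) * (x (n + 1) * (x (n + 2) + x (n + 1) + x n - c) + b)"
      by (simp add: dp1_inv_def algebra_simps)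
    with step[OF Suc] Suc show ?case
      by simp
  qed
  from step[OF this] x0[of "n + 1"] show ?thesis
    by (simp add: field_simps)
qed

end

text \<open>The equation with denominators cleared, valid in any integral domain. In this form it
  applies to polynomial jets, where comparing coefficients differentiates it.\<close>

lemma somos_dp1_bilinear:
  fixes s :: "nat \<Rightarrow> 'a::idom" and b c u v :: 'a
  assumes nz: "\<And>n. s n \<noteq> 0"
    and init: "s 1 = u" "s 2 = 1" "s 3 = 1" "s 4 = 1" "s 5 = v"
    and rec: "\<And>n. s (n + 5) * s n =
      b * s (n + 4) * s (n + 1) - dp1_inv b c u v * s (n + 3) * s (n + 2)"
  shows "s (n + 6) * (s (n + 3))\<^sup>2 * s (n + 2) + (s (n + 5))\<^sup>2 * (s (n + 2))\<^sup>2
      + (s (n + 4))\<^sup>2 * s (n + 5) * s (n + 1)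
    = c * s (n + 5) * s (n + 4) * s (n + 3) * s (n + 2) - b * (s (n + 4))\<^sup>2 * (s (n + 3))\<^sup>2"
    (is "?L = ?R")
proof -
  let ?t = "to_fract :: 'a \<Rightarrow> 'a fract"
  let ?s = "\<lambda>n. ?t (s n)"
  have K: "?t (dp1_inv b c u v) = dp1_inv (?t b) (?t c) (?t u) (?t v)"
    by (simp add: dp1_inv_def)
  have rec': "?s (n + 5) * ?s n =
      ?t b * ?s (n + 4) * ?s (n + 1) - dp1_inv (?t b) (?t c) (?t u) (?t v) * ?s (n + 3) * ?s (n + 2)" for n
    using arg_cong[OF rec[of n], of ?t] by (simp only: to_fract_mult to_fract_diff K)
  have nz': "?s n \<noteq> 0" for n
    using nz by simp
  define a1 a2 a3 a4 a5 a6 where a: "a1 = ?s (n + 1)" "a2 = ?s (n + 2)" "a3 = ?s (n + 3)"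
    "a4 = ?s (n + 4)" "a5 = ?s (n + 5)" "a6 = ?s (n + 6)"
  have n: "a1 \<noteq> 0" "a2 \<noteq> 0" "a3 \<noteq> 0" "a4 \<noteq> 0" "a5 \<noteq> 0"
    using nz' by (simp_all add: a)
  have "a6 * a3 / (a5 * a4) + a5 * a2 / (a4 * a3) + a4 * a1 / (a3 * a2) = ?t c - ?t b / (a5 * a2 / (a4 * a3))"
    using somos_quotient_dp1[of ?s "?t u" "?t v" "?t b" "?t c" n, OF nz' _ _ _ _ _ rec'] init
    by (simp add: a numeral_eq_Suc)
  then have 1: "(a6 * a3 / (a5 * a4) + a5 * a2 / (a4 * a3) + a4 * a1 / (a3 * a2)) * (a5 * a4 * a3 * a2)
     = (?t c - ?t b / (a5 * a2 / (a4 * a3))) * (a5 * a4 * a3 * a2)"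
    by simp
  have 2: "(a6 * a3 / (a5 * a4) + a5 * a2 / (a4 * a3) + a4 * a1 / (a3 * a2)) * (a5 * a4 * a3 * a2)
     = a6 * a3\<^sup>2 * a2 + a5\<^sup>2 * a2\<^sup>2 + a4\<^sup>2 * a5 * a1"
    using n by (simp add: field_simps power2_eq_square)
  have 3: "(?t c - ?t b / (a5 * a2 / (a4 * a3))) * (a5 * a4 * a3 * a2)
     = ?t c * a5 * a4 * a3 * a2 - ?t b * a4\<^sup>2 * a3\<^sup>2"
    using n by (simp add: field_simps power2_eq_square)
  have "?t ?L = ?t ?R"
    using 1 unfolding 2 3 by (simp add: a power2_eq_square)
  then show ?thesis
    by (simp only: to_fract_eq_iff)
qed

lemma somos5_init:
  "somos5 b c u v 0 = u * (c - u - v) - b" "somos5 b c u v 1 = u"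
  "somos5 b c u v 2 = 1" "somos5 b c u v 3 = 1" "somos5 b c u v 4 = 1"
  by (simp_all add: eval_nat_numeral)

lemma somos5_5:
  assumes "somos5 b c u v 0 \<noteq> 0"
  shows "somos5 b c u v 5 = v"
proof -
  have "b * u - dp1_inv b c u v = v * somos5 b c u v 0"
    by (simp add: dp1_inv_def algebra_simps)
  with assms show ?thesis
    by (simp add: eval_nat_numeral somos5.simps(6))
qed

section \<open>The degree sequence\<close>

text \<open>The square is taken over the integers since \<open>n - 3\<close> is negative for the
  first three terms, whose degrees are 2, 1, 0.\<close>

definition tau_degree :: "nat \<Rightarrow> nat" where
  "tau_degree n = nat ((int n - 3)\<^sup>2 div 4)"

lemma tau_degree_eq: "4 * int (tau_degree n) = (int n - 3)\<^sup>2 - (if even n then 1 else 0)"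
proof (cases "even n")
  case True
  then obtain k where "n = 2 * k" by (auto elim: evenE)
  then have "(int n - 3)\<^sup>2 = 4 * (int k * int k - 3 * int k + 2) + 1"
    by (simp add: power2_eq_square algebra_simps)
  moreover from this have "(int n - 3)\<^sup>2 div 4 = int k * int k - 3 * int k + 2"
    by presburger
  ultimately show ?thesis
    using True by (simp add: tau_degree_def) (metis pos_imp_zdiv_nonneg_iff zero_le_power2 zero_less_numeral)
next
  case False
  then obtain k where "n = 2 * k + 1" by (auto elim: oddE)
  then have "(int n - 3)\<^sup>2 = 4 * (int k - 1)\<^sup>2"
    by (simp add: power2_eq_square algebra_simps)
  then show ?thesis
    using False by (simp add: tau_degree_def)
qed

text \<open>The first identity balances the Somos recurrence, 3 being the degree of
  \<open>K\<close>. By the second, the product with \<open>K\<close> exceeds the other one by 2 in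
  degree, so leading parts cannot cancel.\<close>

lemma tau_degree_rec:
  "tau_degree (n + 5) + tau_degree n = tau_degree (n + 3) + tau_degree (n + 2) + 3"
  "tau_degree (n + 4) + tau_degree (n + 1) = tau_degree (n + 3) + tau_degree (n + 2) + 1"
proof -
  have "4 * int (tau_degree (n + 5) + tau_degree n) = 4 * int (tau_degree (n + 3) + tau_degree (n + 2) + 3)"
    "4 * int (tau_degree (n + 4) + tau_degree (n + 1)) = 4 * int (tau_degree (n + 3) + tau_degree (n + 2) + 1)"
    unfolding of_nat_add distrib_left tau_degree_eq by (simp_all add: power2_eq_square algebra_simps)
  then show "tau_degree (n + 5) + tau_degree n = tau_degree (n + 3) + tau_degree (n + 2) + 3"
    "tau_degree (n + 4) + tau_degree (n + 1) = tau_degree (n + 3) + tau_degree (n + 2) + 1"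
    by (metis mult_cancel_left of_nat_eq_iff zero_neq_numeral)+
qed

lemma tau_degree_sum:
  "2 * (tau_degree (n + 4) + tau_degree (n + 3)) = n * n + n"
  "2 * (tau_degree (n + 4) + tau_degree (n + 1)) + n = n * n + 2"
proof -
  have "2 * int (2 * (tau_degree (n + 4) + tau_degree (n + 3))) = 2 * int (n * n + n)"
    "2 * int (2 * (tau_degree (n + 4) + tau_degree (n + 1)) + n) = 2 * int (n * n + 2)"
    using tau_degree_eq[of "n + 4"] tau_degree_eq[of "n + 3"] tau_degree_eq[of "n + 1"]
    by (simp_all add: power2_eq_square algebra_simps split: if_splits)
  then show "2 * (tau_degree (n + 4) + tau_degree (n + 3)) = n * n + n"
    "2 * (tau_degree (n + 4) + tau_degree (n + 1)) + n = n * n + 2"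
    by (metis mult_cancel_left of_nat_eq_iff zero_neq_numeral)+
qed

lemma tau_degree_less: "tau_degree (n + 1) < tau_degree (n + 6)"
proof -
  have "4 * int (tau_degree (n + 1)) < 4 * int (tau_degree (n + 6))"
    unfolding tau_degree_eq by (simp add: power2_eq_square algebra_simps)
  then show ?thesis by linarith
qed

lemma tau_degree_small: "tau_degree 0 = 2" "tau_degree 1 = 1" "tau_degree 2 = 0" "tau_degree 3 = 0"
   "tau_degree 4 = 0" "tau_degree 5 = 1"
  by (simp_all add: tau_degree_def)

lemma total_degree_diff_eq:
  "total_degree q < total_degree p \<Longrightarrow> total_degree (p - q) = total_degree p"
  "total_degree q < total_degree p \<Longrightarrow> total_degree (q - p) = total_degree p"
  "total_degree q < total_degree p \<Longrightarrow> total_degree (p + q) = total_degree p"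
  using degree_add_eq_left[of "- homog q" "homog p"] degree_add_eq_right[of "homog q" "- homog p"]
    degree_add_eq_left[of "homog q" "homog p"]
  by (simp_all add: total_degree_eq is_hom_simps[OF is_hom_homog])

lemma homog_gens:
  "homog px0 = [:0, px0:]" "homog px1 = [:0, px1:]" "homog px2 = [:0, px2:]" "homog (pc k) = [:pc k:]"
  unfolding homog_def by (rule ev3_gens, intro is_hom_comp[OF is_hom_const_poly is_hom_pc])+

lemma total_degree_linear:
  "total_degree (1 - px0) = 1" "total_degree (1 - px2) = 1"
  "total_degree (1 - px0 + (1 - px2) - pc k) = 1"
proof -
  have "px0 \<noteq> 0" "px2 \<noteq> 0" "- px0 \<noteq> px2"
    by (simp_all add: px0_def px2_def)
  moreover have "homog (1 - px0) = [:1, - px0:]" "homog (1 - px2) = [:1, - px2:]"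
    "homog (1 - px0 + (1 - px2) - pc k) = [:2 - pc k, - px0 - px2:]"
    unfolding is_hom_simps[OF is_hom_homog] homog_gens by (simp_all add: one_pCons numeral_poly)
  ultimately show "total_degree (1 - px0) = 1" "total_degree (1 - px2) = 1"
    "total_degree (1 - px0 + (1 - px2) - pc k) = 1"
    by (simp_all add: total_degree_eq)
qed

text \<open>A divisor of \<open>1 - px0\<close> has degree 0 in the outermost variable, so it
  divides every coefficient of \<open>1 - px2\<close>, one of which is a unit.\<close>

lemma coprime_linear: "coprime (1 - px0) (1 - px2)"
proof (rule coprimeI)
  fix p assume p: "p dvd 1 - px0" "p dvd 1 - px2"
  have "1 - px0 = [:[:[:1, - 1:]:]:]" "1 - px2 = [:1, - 1:]"
    by (simp_all add: px0_def px2_def one_pCons)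
  with p have p: "p dvd [:[:[:1, - 1:]:]:]" "p dvd [:1, - 1:]"
    by simp_all
  have "degree p \<le> degree ([:[:[:1, - 1:]:]:] :: poly3)"
    by (rule dvd_imp_degree_le[OF p(1)]) simp
  then obtain q where q: "p = [:q:]"
    by (auto elim: degree_eq_zeroE)
  with p(2) have "q dvd coeff [:1, - 1:] 1"
    by (metis const_poly_dvd_iff)
  then show "is_unit p"
    by (simp add: q is_unit_const_poly_iff)
qed

section \<open>Identities behind the orbit\<close>

text \<open>
  \<open>L\<close> is the invariant whose level set \<open>L = I\<^sub>2\<close> defines \<open>psi\<close>, and the two recurrences are those of
  the 4-dimensional map.
\<close>

lemma I2_invariant:
  fixes h x0 x1 x2 y0 y1 y2 :: "'a::field"
  defines "L \<equiv> \<lambda>x0 x1 x2 x3. 2*h*x0 + x0\<^sup>2 - 2*h*x0*x1 + 2*h*x2 + x0*x2 - h*x1*x2 + h\<^sup>2*x1*x2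
    + 2*h*x0*x1*x2 + x2\<^sup>2 + h*x1*x2\<^sup>2 - h*x0*x3 + h\<^sup>2*x0*x3 + h*x0\<^sup>2*x3 - 2*h*x2*x3 + 2*h*x0*x2*x3"
  assumes "x1 \<noteq> 1"
    and x2: "x2 = - x1 - x0 + h * x1 / (1 - x1)"
    and y2: "y2 = - y0 - y1 + (2 - x1 + h * y1) / (1 - x1)\<^sup>2"
  shows "L x1 y1 x2 y2 = L x0 y0 x1 y1"
proof -
  \<comment> \<open>With the reciprocal as a variable subject to \<open>r * (1 - x1) = 1\<close>,
    the claim becomes a polynomial ideal membership.\<close>
  define r where "r = 1 / (1 - x1)"
  have r: "r * (1 - x1) = 1"
    using assms(2) by (simp add: r_def)
  have "x2 = - x1 - x0 + h * x1 * r" "y2 = - y0 - y1 + (2 - x1 + h * y1) * r\<^sup>2"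
    by (simp_all add: x2 y2 r_def power_divide)
  with r show ?thesis
    unfolding L_def by algebra
qed

text \<open>Here \<open>k\<close> is \<open>1 / (2 * h)\<close> and \<open>1 - u\<close> plays the
  part of \<open>x\<close>. The recurrence of \<open>w\<close> is the linearisation of that of
  \<open>u\<close>, with \<open>(9 + h) * k\<close> as the variation of the constant
  \<open>3 + h\<close>.\<close>

lemma y_recurrence:
  fixes h k :: "'a::field"
  assumes k: "2 * k * h = 1" and u: "u1 \<noteq> 0"
    and ur: "u2 + u1 + u0 = (3 + h) - h / u1"
    and wr: "w2 + w1 + w0 = (9 + h) * k + h * w1 / u1\<^sup>2"
  defines "y \<equiv> \<lambda>u w. - 2 * k - k * u + w"
  shows "y u2 w2 = - y u0 w0 - y u1 w1 + (2 - (1 - u1) + h * y u1 w1) / (1 - (1 - u1))\<^sup>2"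
proof -
  define r where "r = 1 / u1"
  have r: "r * u1 = 1"
    using u by (simp add: r_def)
  have 1: "u2 + u1 + u0 = (3 + h) - h * r" "w2 + w1 + w0 = (9 + h) * k + h * w1 * r\<^sup>2"
    using ur wr by (simp_all add: r_def power_divide)
  have "y u2 w2 = - y u0 w0 - y u1 w1 + (2 - (1 - u1) + h * y u1 w1) * r\<^sup>2"
    using r 1 k unfolding y_def by algebra
  then show ?thesis
    by (simp add: r_def power_divide)
qed

text \<open>\<open>q1\<close> is the formal derivative of \<open>q0\<close>, with \<open>b\<close>
  constant and \<open>c'\<close> the derivative of \<open>c\<close>; \<open>W\<close> is the
  quotient rule for the Somos quotients. In logarithmic derivatives each \<open>W\<close> is the
  quotient times a signed sum of four terms.\<close>

lemma log_derivative_recurrence: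
  fixes a1 a2 a3 a4 a5 a6 :: "'a::field"
  assumes nz: "a1 \<noteq> 0" "a2 \<noteq> 0" "a3 \<noteq> 0" "a4 \<noteq> 0" "a5 \<noteq> 0" "a6 \<noteq> 0"
    and q0: "a6 * a3\<^sup>2 * a2 + a5\<^sup>2 * a2\<^sup>2 + a4\<^sup>2 * a5 * a1 = c * a5 * a4 * a3 * a2 - b * a4\<^sup>2 * a3\<^sup>2"
    and q1: "s6 * a3\<^sup>2 * a2 + a6 * (2 * a3 * s3) * a2 + a6 * a3\<^sup>2 * s2
       + (2 * a5 * s5 * a2\<^sup>2 + a5\<^sup>2 * (2 * a2 * s2))
       + (2 * a4 * s4 * a5 * a1 + a4\<^sup>2 * s5 * a1 + a4\<^sup>2 * a5 * s1)
     = c' * a5 * a4 * a3 * a2 + c * (s5 * a4 * a3 * a2 + a5 * s4 * a3 * a2 + a5 * a4 * s3 * a2 + a5 * a4 * a3 * s2)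
       - b * (2 * a4 * s4 * a3\<^sup>2 + a4\<^sup>2 * (2 * a3 * s3))"
  defines "W \<equiv> \<lambda>a b c d a' b' c' d'. ((a' * b + a * b') * (c * d) - a * b * (c' * d + c * d')) / (c * d)\<^sup>2"
  shows "W a6 a3 a5 a4 s6 s3 s5 s4 + W a5 a2 a4 a3 s5 s2 s4 s3 + W a4 a1 a3 a2 s4 s1 s3 s2
     = c' + b * W a5 a2 a4 a3 s5 s2 s4 s3 / (a5 * a2 / (a4 * a3))\<^sup>2"
proof -
  define l1 l2 l3 l4 l5 l6 where l: "l1 = s1 / a1" "l2 = s2 / a2" "l3 = s3 / a3"
     "l4 = s4 / a4" "l5 = s5 / a5" "l6 = s6 / a6"
  have s: "s1 = l1 * a1" "s2 = l2 * a2" "s3 = l3 * a3" "s4 = l4 * a4" "s5 = l5 * a5" "s6 = l6 * a6"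
    using nz by (simp_all add: l)
  have W: "W a6 a3 a5 a4 s6 s3 s5 s4 = a6 * a3 / (a5 * a4) * (l6 + l3 - l5 - l4)"
    "W a5 a2 a4 a3 s5 s2 s4 s3 = a5 * a2 / (a4 * a3) * (l5 + l2 - l4 - l3)"
    "W a4 a1 a3 a2 s4 s1 s3 s2 = a4 * a1 / (a3 * a2) * (l4 + l1 - l3 - l2)"
    using nz by (simp_all add: W_def s field_simps power2_eq_square)
  \<comment> \<open>This is \<open>q1\<close> minus \<open>l2 + l3 + l4 + l5\<close> times
    \<open>q0\<close>.\<close>
  have "a6 * a3\<^sup>2 * a2 * (l6 + l3 - l5 - l4) + a5\<^sup>2 * a2\<^sup>2 * (l5 + l2 - l4 - l3)
      + a4\<^sup>2 * a5 * a1 * (l4 + l1 - l3 - l2)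
     = c' * a5 * a4 * a3 * a2 + b * a4\<^sup>2 * a3\<^sup>2 * (l5 + l2 - l4 - l3)"
    using q0 q1 unfolding s by algebra
  then have "(a6 * a3\<^sup>2 * a2 * (l6 + l3 - l5 - l4) + a5\<^sup>2 * a2\<^sup>2 * (l5 + l2 - l4 - l3)
      + a4\<^sup>2 * a5 * a1 * (l4 + l1 - l3 - l2)) / (a5 * a4 * a3 * a2)
     = (c' * a5 * a4 * a3 * a2 + b * a4\<^sup>2 * a3\<^sup>2 * (l5 + l2 - l4 - l3)) / (a5 * a4 * a3 * a2)"
    by simp
  then show ?thesis
    unfolding W using nz by (simp add: add_divide_distrib power2_eq_square ac_simps)
qed

lemma nat_cases_5: "n = 0 \<or> n = 1 \<or> n = 2 \<or> n = 3 \<or> n = 4 \<or> (\<exists>m. n = m + 5)" for n :: nat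
  by presburger

subsection \<open>The orbit of psi\<close>

locale psi_orbit =
  fixes h I2 :: complex
  assumes h: "h \<noteq> 0"
begin

abbreviation "kappa \<equiv> 1 / (2 * h)"

definition "U = 1 - px0"
definition "V = 1 - px2"
definition "B = pc h"
definition "C = pc (3 + h)"
definition "tau = somos5 B C U V"
definition "tau_t = somos5 B (C + pc ((9 + h) * kappa) * px1) U V"
definition "D = pc h * (- px0 + pc h * px0 + px0\<^sup>2 - 2 * px2 + 2 * px0 * px2)"
definition "N = pc I2 - (px0\<^sup>2 + px0 * px2 + px2\<^sup>2) - 2 * pc h * (px0 - px0 * px1 + px2)
  - pc h * px1 * px2 * (2 * px0 + px2 - 1 + pc h)"

text \<open>
  In \<open>tau_t\<close> the variable \<open>px1\<close> is the deformation parameter of \<open>c\<close>, whereas \<open>px1\<close> in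
  \<open>W0\<close> and \<open>W1\<close> is the coordinate \<open>x\<^sub>1\<close>. The infinitesimal of \<open>jet\<close> is scaled by \<open>D\<close>, so that the
  initial tangent vector, which has \<open>D\<close> as denominator, becomes polynomial.
\<close>

definition "W0 = D * (px1 + pc kappa * (2 + U))"
definition "W1 = N + D * (pc kappa * (2 + V))"
definition "jet = ev3 (\<lambda>k. [:pc k:]) [:px0, - W0:] [:0, D:] [:px2, - W1:]"
text \<open>Jets are not truncated: the full polynomial ring is an integral domain, where
  cancellation is possible, and coefficients 0 and 1 of a product depend only on those of its
  factors.\<close>

definition "sigma n = coeff (jet (tau_t n)) 1"

lemma is_hom_jet: "is_hom jet"
  unfolding jet_def by (intro is_hom_ev3 is_hom_comp[OF is_hom_const_poly is_hom_pc])

lemma jet_gens: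
  "jet px0 = [:px0, - W0:]" "jet px1 = [:0, D:]" "jet px2 = [:px2, - W1:]" "jet (pc k) = [:pc k:]"
  unfolding jet_def by (rule ev3_gens, intro is_hom_comp[OF is_hom_const_poly is_hom_pc])+

lemma jet_UV: "jet U = [:U, W0:]" "jet V = [:V, W1:]"
  unfolding U_def V_def is_hom_simps[OF is_hom_jet] jet_gens by (simp_all add: one_pCons)

lemma unit_B: "is_unit B"
  using h by (simp add: B_def pc_def is_unit_const_poly_iff dvd_field_iff)

lemma tau_rec: "tau (n + 5) * tau n = B * tau (n + 4) * tau (n + 1) - dp1_inv B C U V * tau (n + 3) * tau (n + 2)"
  unfolding tau_def using somos5_rec[OF unit_B, of U V C n] coprime_linear by (simp add: U_def V_def)

lemma tau_coprime: "j \<in> {1..4} \<Longrightarrow> coprime (tau (n + j)) (tau n)"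
  unfolding tau_def using somos5_coprime[OF unit_B, of U V j C n] coprime_linear by (simp add: U_def V_def)

lemma params_nz: "U \<noteq> 0" "V \<noteq> 0" "B \<noteq> 0" "U + V - C \<noteq> 0" "D \<noteq> 0"
proof -
  show "U \<noteq> 0" "V \<noteq> 0" "U + V - C \<noteq> 0"
    using total_degree_linear by (metis U_def V_def C_def total_degree_0 zero_neq_one)+
  show "B \<noteq> 0"
    using h by (simp add: B_def pc_def)
  have "coeff (coeff (coeff (- px0 + pc h * px0 + px0\<^sup>2 - 2 * px2 + 2 * px0 * px2) 0) 0) 2 = 1"
    by (simp add: px0_def px2_def pc_def power2_eq_square coeff_pCons numeral_eq_Suc)
  then have "- px0 + pc h * px0 + px0\<^sup>2 - 2 * px2 + 2 * px0 * px2 \<noteq> 0"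
    by (metis coeff_0 zero_neq_one)
  with h show "D \<noteq> 0"
    by (simp add: D_def pc_def)
qed

lemma total_degree_params:
  "total_degree U = 1" "total_degree V = 1" "total_degree (U + V - C) = 1"
  "total_degree B = 0" "total_degree C = 0"
  using total_degree_linear total_degree_gens by (simp_all add: U_def V_def B_def C_def)

lemma total_degree_inv: "total_degree (dp1_inv B C U V) = 3" "dp1_inv B C U V \<noteq> 0"
proof -
  have 1: "total_degree (U * V * (U + V - C)) = 3"
    using params_nz total_degree_params by (simp add: total_degree_mult)
  have "total_degree (B * (U + V)) \<le> 1"
    using total_degree_mult_le[of B "U + V"] total_degree_add_le[of U V] total_degree_params by simp
  with 1 show *: "total_degree (dp1_inv B C U V) = 3"
    unfolding dp1_inv_def by (subst total_degree_diff_eq(3)) simp_all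
  show "dp1_inv B C U V \<noteq> 0"
    using * by auto
qed

lemma tau_init: "tau 0 = - (U * (U + V - C)) - B" "tau 1 = U" "tau 2 = 1" "tau 3 = 1" "tau 4 = 1"
  unfolding tau_def somos5_init by (simp_all add: algebra_simps)

text \<open>The product with \<open>K\<close> strictly dominates in the recurrence, so the degree is
  exact and no term vanishes.\<close>

lemma tau_nz_degree: "tau n \<noteq> 0 \<and> total_degree (tau n) = tau_degree n"
proof (induction n rule: less_induct)
  case (less n)
  consider "n = 0" | "n = 1" | "n = 2" | "n = 3" | "n = 4" | m where "n = m + 5"
    using nat_cases_5[of n] by blast
  then show ?case
  proof cases
    case 1
    have "total_degree (tau 0) = 2"
      unfolding tau_init using params_nz total_degree_params
      by (subst total_degree_diff_eq(1)) (simp_all add: total_degree_gens total_degree_mult del: mult_minus_left mult_minus_right)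
    with 1 show ?thesis
      by (auto simp: tau_degree_small)
  next
    case (6 m)
    have IH: "tau (m + i) \<noteq> 0" "total_degree (tau (m + i)) = tau_degree (m + i)" if "i < 5" for i
      using less[of "m + i"] that 6 by auto
    have 1: "total_degree (B * tau (m + 4) * tau (m + 1)) = tau_degree (m + 4) + tau_degree (m + 1)"
      using IH[of 4] IH[of 1] params_nz total_degree_params by (simp add: total_degree_mult)
    have 2: "total_degree (dp1_inv B C U V * tau (m + 3) * tau (m + 2)) = 3 + tau_degree (m + 3) + tau_degree (m + 2)"
      using IH[of 3] IH[of 2] total_degree_inv by (simp add: total_degree_mult)
    have 3: "total_degree (tau (m + 5) * tau m) = 3 + tau_degree (m + 3) + tau_degree (m + 2)"
      unfolding tau_rec using 1 2 tau_degree_rec(2)[of m] by (subst total_degree_diff_eq(2)) simp_all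
    then have "tau (m + 5) \<noteq> 0"
      by auto
    with 3 IH[of 0] tau_degree_rec(1)[of m] show ?thesis
      by (simp add: 6 total_degree_mult)
  qed (use params_nz total_degree_params in \<open>simp_all add: tau_init tau_degree_small total_degree_gens del: One_nat_def\<close>)
qed

lemma tau_nz [simp]: "tau n \<noteq> 0"
  using tau_nz_degree by simp

lemma total_degree_tau [simp]: "total_degree (tau n) = tau_degree n"
  using tau_nz_degree by simp

lemma tau_5: "tau 5 = V"
  using somos5_5[of B C U V] tau_nz[of 0] by (simp add: tau_def)

section \<open>First-order jets of the Somos sequence\<close>

definition "jB = [:B:]"
definition "jC = [:C, pc ((9 + h) * kappa) * D:]"
definition "jU = [:U, W0:]"
definition "jV = [:V, W1:]"

lemma jet_params: "jet B = jB" "jet (C + pc ((9 + h) * kappa) * px1) = jC" "jet U = jU" "jet V = jV"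
  by (simp_all add: jB_def jC_def jU_def jV_def jet_UV B_def C_def is_hom_simps[OF is_hom_jet] jet_gens)

lemma jet_inv: "jet (dp1_inv B (C + pc ((9 + h) * kappa) * px1) U V) = dp1_inv jB jC jU jV"
  unfolding dp1_inv_def jet_params[symmetric] by (simp only: is_hom_simps[OF is_hom_jet])

lemma jet_rec: "jet (tau_t (n + 5)) * jet (tau_t n)
   = jB * jet (tau_t (n + 4)) * jet (tau_t (n + 1)) - dp1_inv jB jC jU jV * jet (tau_t (n + 3)) * jet (tau_t (n + 2))"
  using arg_cong[OF somos5_rec[OF unit_B, of U V "C + pc ((9 + h) * kappa) * px1" n], of jet] coprime_linear
  by (simp only: tau_t_def[symmetric] U_def[symmetric] V_def[symmetric] is_hom_simps[OF is_hom_jet] jet_params jet_inv)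

lemma is_hom_coeff_0: "is_hom (\<lambda>p. coeff p 0)"
  by (simp add: is_hom_def coeff_mult)

lemma coeff_dp1_inv_0: "coeff (dp1_inv jB jC jU jV) 0 = dp1_inv B C U V"
  unfolding dp1_inv_def by (simp add: is_hom_simps[OF is_hom_coeff_0] jB_def jC_def jU_def jV_def)

lemma tau_t_init:
  "tau_t 0 = U * (C + pc ((9 + h) * kappa) * px1 - U - V) - B"
  "tau_t 1 = U" "tau_t 2 = 1" "tau_t 3 = 1" "tau_t 4 = 1"
  unfolding tau_t_def somos5_init by simp_all

lemma jet_init: "jet (tau_t 0) = jU * (jC - jU - jV) - jB" "jet (tau_t 1) = jU" "jet (tau_t 2) = 1"
  "jet (tau_t 3) = 1" "jet (tau_t 4) = 1"
  unfolding tau_t_init is_hom_diff[OF is_hom_jet] is_hom_mult[OF is_hom_jet, of U] jet_params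
  by (simp_all add: is_hom_simps[OF is_hom_jet])

text \<open>The deformation parameter is sent to a multiple of the infinitesimal, so at order 0 both
  sides have the same initial values and recurrence; \<open>tau m\<close> can be cancelled.\<close>

lemma coeff_jet_0: "coeff (jet (tau_t n)) 0 = tau n"
proof (induction n rule: less_induct)
  case (less n)
  consider "n = 0" | "n = 1" | "n = 2" | "n = 3" | "n = 4" | m where "n = m + 5"
    using nat_cases_5[of n] by blast
  then show ?case
  proof cases
    case (6 m)
    have IH: "coeff (jet (tau_t (m + i))) 0 = tau (m + i)" if "i < 5" for i
      using less[of "m + i"] that 6 by auto
    have "coeff (jet (tau_t (m + 5))) 0 * tau m = tau (m + 5) * tau m"
      using arg_cong[OF jet_rec[of m], of "\<lambda>p. coeff p 0"] IH[of 0] IH[of 1] IH[of 2] IH[of 3] IH[of 4]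
      unfolding tau_rec is_hom_simps[OF is_hom_coeff_0] coeff_dp1_inv_0 by (simp add: jB_def)
    then show ?thesis
      by (simp add: 6)
  qed (simp_all only: jet_init tau_init, simp_all add: is_hom_simps[OF is_hom_coeff_0] jB_def jC_def jU_def jV_def algebra_simps)
qed

lemma jet_nz: "jet (tau_t n) \<noteq> 0"
  using coeff_jet_0[of n] by (intro notI) simp

lemma jet_5: "jet (tau_t 5) = jV"
proof -
  have "tau_t 0 \<noteq> 0"
    using jet_nz[of 0] by (auto simp: is_hom_zero[OF is_hom_jet])
  then show ?thesis
    using somos5_5[of B "C + pc ((9 + h) * kappa) * px1" U V] jet_params by (simp add: tau_t_def)
qed

lemma coeff_mult_1: "coeff (p * q) 1 = coeff p 0 * coeff q 1 + coeff p 1 * coeff q 0"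
  by (simp add: coeff_mult)

text \<open>The surplus 2 comes from the scaling by \<open>D\<close>, of degree at most 2. Products
  do not increase it, since each term of the product rule contains a single derivative.\<close>

definition jet_degree_le :: "nat \<Rightarrow> poly3 poly \<Rightarrow> bool" where
  "jet_degree_le d p \<longleftrightarrow> total_degree (coeff p 0) \<le> d \<and> total_degree (coeff p 1) \<le> d + 2"

lemma jet_degree_le_mult: "jet_degree_le d p \<Longrightarrow> jet_degree_le e q \<Longrightarrow> jet_degree_le (d + e) (p * q)"
  unfolding jet_degree_le_def is_hom_mult[OF is_hom_coeff_0] coeff_mult_1
  using total_degree_mult_le[of "coeff p 0" "coeff q 0"] total_degree_mult_le[of "coeff p 0" "coeff q 1"]
    total_degree_mult_le[of "coeff p 1" "coeff q 0"]
    total_degree_add_le[of "coeff p 0 * coeff q 1" "coeff p 1 * coeff q 0"]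
  by linarith

lemma jet_degree_le_add: "jet_degree_le d p \<Longrightarrow> jet_degree_le d q \<Longrightarrow> jet_degree_le d (p + q)"
  unfolding jet_degree_le_def coeff_add
  using total_degree_add_le[of "coeff p 0" "coeff q 0"] total_degree_add_le[of "coeff p 1" "coeff q 1"]
  by linarith

lemma jet_degree_le_diff: "jet_degree_le d p \<Longrightarrow> jet_degree_le d q \<Longrightarrow> jet_degree_le d (p - q)"
  unfolding jet_degree_le_def coeff_diff
  using total_degree_diff_le[of "coeff p 0" "coeff q 0"] total_degree_diff_le[of "coeff p 1" "coeff q 1"]
  by linarith

lemma jet_degree_le_mono: "jet_degree_le d p \<Longrightarrow> d \<le> e \<Longrightarrow> jet_degree_le e p"
  unfolding jet_degree_le_def by linarith

lemma total_degree_le_atoms: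
  "total_degree px0 \<le> 1" "total_degree px1 \<le> 1" "total_degree px2 \<le> 1" "total_degree (pc z) \<le> 0"
  "total_degree 1 \<le> 0" "total_degree (numeral k) \<le> 0"
  by (simp_all add: total_degree_gens)

lemma total_degree_le_ops:
  "total_degree p \<le> d \<Longrightarrow> total_degree q \<le> e \<Longrightarrow> total_degree (p + q) \<le> max d e"
  "total_degree p \<le> d \<Longrightarrow> total_degree q \<le> e \<Longrightarrow> total_degree (p - q) \<le> max d e"
  "total_degree p \<le> d \<Longrightarrow> total_degree q \<le> e \<Longrightarrow> total_degree (p * q) \<le> d + e"
  "total_degree p \<le> d \<Longrightarrow> total_degree (- p) \<le> d"
  "total_degree p \<le> d \<Longrightarrow> total_degree (p\<^sup>2) \<le> d + d"
  using total_degree_add_le[of p q] total_degree_diff_le[of p q] total_degree_mult_le[of p q]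
    total_degree_mult_le[of p p]
  by (simp_all add: total_degree_gens power2_eq_square)

lemmas total_degree_le = total_degree_le_atoms total_degree_le_ops

lemma total_degree_D: "total_degree D \<le> 2"
  unfolding D_def by (rule order.trans, (rule total_degree_le)+) simp

lemma total_degree_N: "total_degree N \<le> 3"
  unfolding N_def by (rule order.trans, (rule total_degree_le)+) simp

lemma total_degree_W: "total_degree W0 \<le> 3" "total_degree W1 \<le> 3"
  unfolding W0_def W1_def U_def V_def
  by (rule order.trans, (rule total_degree_le total_degree_D total_degree_N)+, simp)+

lemma jet_degree_le_params:
  "jet_degree_le 0 jB" "jet_degree_le 0 jC" "jet_degree_le 1 jU" "jet_degree_le 1 jV"
  "jet_degree_le 3 (dp1_inv jB jC jU jV)"
proof -
  show B: "jet_degree_le 0 jB" and U: "jet_degree_le 1 jU" and V: "jet_degree_le 1 jV"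
    using total_degree_params total_degree_W by (simp_all add: jet_degree_le_def jB_def jU_def jV_def)
  have "total_degree (pc ((9 + h) * kappa) * D) \<le> 0 + 2"
    by (rule total_degree_le total_degree_D)+
  then show C: "jet_degree_le 0 jC"
    using total_degree_params by (simp add: jet_degree_le_def jC_def)
  have "jet_degree_le ((1 + 1) + 1) (jU * jV * (jU + jV - jC))"
    by (intro jet_degree_le_mult jet_degree_le_add jet_degree_le_diff U V jet_degree_le_mono[OF C]) simp
  moreover have "jet_degree_le (0 + 1) (jB * (jU + jV))"
    by (intro jet_degree_le_mult jet_degree_le_add B U V)
  ultimately show "jet_degree_le 3 (dp1_inv jB jC jU jV)"
    unfolding dp1_inv_def by (intro jet_degree_le_add) (auto intro: jet_degree_le_mono)
qed

text \<open>At order 1 the recurrence determines \<open>sigma (m + 5) * tau m\<close>. As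
  \<open>sigma (m + 5)\<close> is a polynomial, its degree bound follows by subtracting the exact
  degree of \<open>tau m\<close>, so the surplus 2 does not grow with \<open>n\<close>.\<close>

lemma jet_degree_le_jet: "jet_degree_le (tau_degree n) (jet (tau_t n))"
proof (induction n rule: less_induct)
  case (less n)
  consider "n = 0" | "n = 1" | "n = 2" | "n = 3" | "n = 4" | m where "n = m + 5"
    using nat_cases_5[of n] by blast
  then show ?case
  proof cases
    case 1
    have "jet_degree_le (1 + 1) (jU * (jC - jU - jV) - jB)"
      by (intro jet_degree_le_diff[OF jet_degree_le_mult] jet_degree_le_diff jet_degree_le_params
          jet_degree_le_mono[OF jet_degree_le_params(1)] jet_degree_le_mono[OF jet_degree_le_params(2)]) simp_all
    with 1 show ?thesis
      by (simp add: tau_degree_small jet_init flip: One_nat_def)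
  next
    case (6 m)
    have IH: "jet_degree_le (tau_degree (m + i)) (jet (tau_t (m + i)))" if "i < 5" for i
      using less[of "m + i"] that 6 by auto
    let ?R = "jB * jet (tau_t (m + 4)) * jet (tau_t (m + 1))
      - dp1_inv jB jC jU jV * jet (tau_t (m + 3)) * jet (tau_t (m + 2))"
    have "jet_degree_le (0 + tau_degree (m + 4) + tau_degree (m + 1)) (jB * jet (tau_t (m + 4)) * jet (tau_t (m + 1)))"
      "jet_degree_le (3 + tau_degree (m + 3) + tau_degree (m + 2))
        (dp1_inv jB jC jU jV * jet (tau_t (m + 3)) * jet (tau_t (m + 2)))"
      by (intro jet_degree_le_mult jet_degree_le_params IH; simp)+
    then have "jet_degree_le (tau_degree (m + 5) + tau_degree m) ?R"
      using tau_degree_rec[of m] by (intro jet_degree_le_diff) (auto intro: jet_degree_le_mono)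
    then have R: "total_degree (coeff ?R 1) \<le> tau_degree (m + 5) + tau_degree m + 2"
      by (simp add: jet_degree_le_def)
    have "tau (m + 5) * sigma m + sigma (m + 5) * tau m = coeff ?R 1"
      unfolding jet_rec[symmetric] coeff_mult_1 coeff_jet_0 sigma_def by simp
    then have "sigma (m + 5) * tau m = coeff ?R 1 - tau (m + 5) * sigma m"
      by (simp add: algebra_simps)
    moreover have "total_degree (tau (m + 5) * sigma m) \<le> tau_degree (m + 5) + (tau_degree m + 2)"
      using IH[of 0] by (intro total_degree_le) (simp_all add: jet_degree_le_def sigma_def)
    ultimately have le: "total_degree (sigma (m + 5) * tau m) \<le> tau_degree (m + 5) + tau_degree m + 2"
      using total_degree_diff_le[of "coeff ?R 1" "tau (m + 5) * sigma m"] R by simp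
    have "total_degree (sigma (m + 5)) \<le> tau_degree (m + 5) + 2"
    proof (cases "sigma (m + 5) = 0")
      case False
      with le show ?thesis
        by (simp add: total_degree_mult)
    qed simp
    then show ?thesis
      by (simp add: 6 jet_degree_le_def coeff_jet_0 sigma_def)
  qed (use jet_degree_le_params in \<open>simp_all add: tau_degree_small jet_init jet_degree_le_def total_degree_gens flip: One_nat_def\<close>)
qed

lemma total_degree_sigma: "total_degree (sigma n) \<le> tau_degree n + 2"
  using jet_degree_le_jet[of n] by (simp add: jet_degree_le_def sigma_def)

lemma sigma_init: "sigma 1 = W0" "sigma 2 = 0" "sigma 3 = 0" "sigma 4 = 0" "sigma 5 = W1"
  by (simp_all only: sigma_def jet_init jet_5) (simp_all add: jU_def jV_def)

section \<open>The orbit in closed form\<close>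

abbreviation "F \<equiv> to_fract :: poly3 \<Rightarrow> ratfun3"

definition "u n = F (tau (n + 4)) * F (tau (n + 1)) / (F (tau (n + 3)) * F (tau (n + 2)))"
text \<open>The derivative of \<open>u n\<close> by the quotient rule, with the scaling of the
  infinitesimal undone by the division by \<open>D\<close>.\<close>

definition "w n = ((F (sigma (n + 4)) * F (tau (n + 1)) + F (tau (n + 4)) * F (sigma (n + 1)))
     * (F (tau (n + 3)) * F (tau (n + 2)))
   - F (tau (n + 4)) * F (tau (n + 1)) * (F (sigma (n + 3)) * F (tau (n + 2)) + F (tau (n + 3)) * F (sigma (n + 2))))
   / (F (tau (n + 3)) * F (tau (n + 2)))\<^sup>2 / F D"

text \<open>
  The shift of \<open>y\<close> by a constant and a multiple of \<open>u\<close> turns the inhomogeneous term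
  \<open>(2 - x) / (1 - x)\<^sup>2\<close> of the recurrence of \<open>y\<close> into the constant \<open>(9 + h) / (2 h)\<close>, that is, into
  the derivative of the recurrence of \<open>u\<close> in its parameter \<open>c\<close>.
\<close>

definition "x n = 1 - u n"
definition "y n = - 2 * const3 kappa - const3 kappa * u n + w n"

lemma u_nz: "u n \<noteq> 0"
  by (simp add: u_def)

lemma scalars: "2 * const3 kappa * const3 h = 1" "F C = 3 + const3 h" "F B = const3 h"
    "F (pc ((9 + h) * kappa)) = (9 + const3 h) * const3 kappa"
proof -
  have "2 * const3 kappa * const3 h = const3 (2 * kappa * h)"
    by (simp only: is_hom_simps[OF is_hom_const3])
  also have "2 * kappa * h = 1"
    using h by simp
  finally show "2 * const3 kappa * const3 h = 1"
    by (simp add: is_hom_simps[OF is_hom_const3])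
qed (simp_all only: C_def B_def const3_eq[symmetric] is_hom_simps[OF is_hom_const3])

lemma u_rec: "u (n + 2) + u (n + 1) + u n = (3 + const3 h) - const3 h / u (n + 1)"
proof -
  have K: "F (dp1_inv B C U V) = dp1_inv (F B) (F C) (F U) (F V)"
    by (simp add: dp1_inv_def)
  have "F (tau (n + 5)) * F (tau n) = F B * F (tau (n + 4)) * F (tau (n + 1))
      - dp1_inv (F B) (F C) (F U) (F V) * F (tau (n + 3)) * F (tau (n + 2))" for n
    using arg_cong[OF tau_rec[of n], of F] by (simp only: to_fract_mult to_fract_diff K)
  from somos_quotient_dp1[OF _ _ _ _ _ _ this, of n]
  show ?thesis
    by (simp add: u_def scalars tau_init tau_5 del: One_nat_def)
qed

text \<open>Coefficients 0 and 1 of the cleared equation for the jets are the two hypotheses of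
  \<open>log_derivative_recurrence\<close>.\<close>

lemma w_rec:
  "w (n + 2) + w (n + 1) + w n = (9 + const3 h) * const3 kappa + const3 h * w (n + 1) / (u (n + 1))\<^sup>2"
proof -
  let ?J = "\<lambda>n. jet (tau_t n)"
  have J: "?J (n + 6) * (?J (n + 3))\<^sup>2 * ?J (n + 2) + (?J (n + 5))\<^sup>2 * (?J (n + 2))\<^sup>2
      + (?J (n + 4))\<^sup>2 * ?J (n + 5) * ?J (n + 1)
    = jC * ?J (n + 5) * ?J (n + 4) * ?J (n + 3) * ?J (n + 2) - jB * (?J (n + 4))\<^sup>2 * (?J (n + 3))\<^sup>2"
    by (rule somos_dp1_bilinear[OF jet_nz jet_init(2-5) jet_5 jet_rec])
  have c0: "coeff jC 0 = C" "coeff jB 0 = B" "coeff jC 1 = pc ((9 + h) * kappa) * D" "coeff jB 1 = 0"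
    by (simp_all add: jC_def jB_def)
  let ?a = "\<lambda>n. F (tau n)" and ?s = "\<lambda>n. F (sigma n)"
  have q0: "?a (n + 6) * (?a (n + 3))\<^sup>2 * ?a (n + 2) + (?a (n + 5))\<^sup>2 * (?a (n + 2))\<^sup>2
      + (?a (n + 4))\<^sup>2 * ?a (n + 5) * ?a (n + 1)
    = F C * ?a (n + 5) * ?a (n + 4) * ?a (n + 3) * ?a (n + 2) - F B * (?a (n + 4))\<^sup>2 * (?a (n + 3))\<^sup>2"
    using arg_cong[OF J, of "\<lambda>p. F (coeff p 0)"]
    by (simp only: is_hom_simps[OF is_hom_coeff_0] is_hom_simps[OF is_hom_to_fract] coeff_jet_0 c0)
  have q1: "?s (n + 6) * (?a (n + 3))\<^sup>2 * ?a (n + 2) + ?a (n + 6) * (2 * ?a (n + 3) * ?s (n + 3)) * ?a (n + 2)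
       + ?a (n + 6) * (?a (n + 3))\<^sup>2 * ?s (n + 2)
       + (2 * ?a (n + 5) * ?s (n + 5) * (?a (n + 2))\<^sup>2 + (?a (n + 5))\<^sup>2 * (2 * ?a (n + 2) * ?s (n + 2)))
       + (2 * ?a (n + 4) * ?s (n + 4) * ?a (n + 5) * ?a (n + 1) + (?a (n + 4))\<^sup>2 * ?s (n + 5) * ?a (n + 1)
         + (?a (n + 4))\<^sup>2 * ?a (n + 5) * ?s (n + 1))
     = F (pc ((9 + h) * kappa) * D) * ?a (n + 5) * ?a (n + 4) * ?a (n + 3) * ?a (n + 2)
       + F C * (?s (n + 5) * ?a (n + 4) * ?a (n + 3) * ?a (n + 2) + ?a (n + 5) * ?s (n + 4) * ?a (n + 3) * ?a (n + 2)
         + ?a (n + 5) * ?a (n + 4) * ?s (n + 3) * ?a (n + 2) + ?a (n + 5) * ?a (n + 4) * ?a (n + 3) * ?s (n + 2))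
       - F B * (2 * ?a (n + 4) * ?s (n + 4) * (?a (n + 3))\<^sup>2 + (?a (n + 4))\<^sup>2 * (2 * ?a (n + 3) * ?s (n + 3)))"
    using arg_cong[OF J, of "\<lambda>p. F (coeff p 1)"]
    unfolding power2_eq_square coeff_add coeff_diff coeff_mult_1
    unfolding is_hom_simps[OF is_hom_coeff_0] is_hom_simps[OF is_hom_to_fract] coeff_jet_0 c0 sigma_def[symmetric]
    by (simp add: algebra_simps)
  define W where "W n = w n * F D" for n
  have D: "F D \<noteq> 0"
    using params_nz by simp
  have "W (n + 2) + W (n + 1) + W n = F (pc ((9 + h) * kappa) * D) + F B * W (n + 1) / (u (n + 1))\<^sup>2"
    using log_derivative_recurrence[OF _ _ _ _ _ _ q0 q1] D
    by (simp add: W_def w_def u_def numeral_eq_Suc)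
  then have "(W (n + 2) + W (n + 1) + W n) / F D = (F (pc ((9 + h) * kappa) * D) + F B * W (n + 1) / (u (n + 1))\<^sup>2) / F D"
    by simp
  then show ?thesis
    unfolding to_fract_mult scalars using D by (simp add: W_def add_divide_distrib)
qed


lemma x_rec: "x (n + 2) = - x (n + 1) - x n + const3 h * x (n + 1) / (1 - x (n + 1))"
proof -
  have e: "const3 h * x (n + 1) / (1 - x (n + 1)) = const3 h / u (n + 1) - const3 h"
    using u_nz[of "n + 1"] by (simp add: x_def field_simps)
  show ?thesis
    unfolding e using u_rec[of n] by (simp add: x_def algebra_simps)
qed

lemma y_rec: "y (n + 2) = - y n - y (n + 1) + (2 - x (n + 1) + const3 h * y (n + 1)) / (1 - x (n + 1))\<^sup>2"
  unfolding x_def y_def by (rule y_recurrence[OF scalars(1) u_nz u_rec w_rec])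

lemma orbit_init: "x 0 = X0" "x 1 = X2" "y 0 = X1" "y 1 = F N / F D"
proof -
  have D: "F D \<noteq> 0"
    using params_nz by simp
  have t: "tau (1 + 4) = V" "tau (1 + 1) = 1" "tau (1 + 3) = 1" "tau (1 + 2) = 1"
    "sigma (1 + 4) = W1" "sigma (1 + 1) = 0" "sigma (1 + 3) = 0" "sigma (1 + 2) = 0"
    using tau_init tau_5 sigma_init by (simp_all add: numeral_eq_Suc)
  have u: "u 0 = F U" "u 1 = F V"
    unfolding u_def t by (simp_all add: tau_init flip: One_nat_def)
  show "x 0 = X0" "x 1 = X2"
    by (simp_all add: x_def u U_def V_def X_eq flip: One_nat_def)
  have "w 0 = F W0 / F D" "w 1 = F W1 / F D"
    unfolding w_def t by (simp_all add: tau_init sigma_init flip: One_nat_def)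
  with D show "y 0 = X1" "y 1 = F N / F D"
    unfolding y_def u W0_def W1_def
    by (simp_all add: X_eq const3_eq is_hom_simps[OF is_hom_to_fract] add_divide_distrib algebra_simps flip: One_nat_def)
qed

definition "Dx a b = const3 h * (- a + const3 h * a + a\<^sup>2 - 2 * b + 2 * a * b)"
definition "Nx a b c = const3 I2 - (a\<^sup>2 + a * c + c\<^sup>2) - 2 * const3 h * (a - a * b + c)
  - const3 h * b * c * (2 * a + c - 1 + const3 h)"

lemma eval_DN: "eval3 D (a, b, c) = Dx a c" "eval3 N (a, b, c) = Nx a b c"
  unfolding eval3_eq D_def N_def is_hom_simps[OF is_hom_ev3[OF is_hom_const3]] ev3_gens[OF is_hom_const3]
  by (simp_all only: Dx_def Nx_def)

lemma F_DN: "F D = Dx X0 X2" "F N = Nx X0 X1 X2"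
  unfolding D_def N_def is_hom_simps[OF is_hom_to_fract] X_eq[symmetric] const3_eq[symmetric]
  by (simp_all only: Dx_def Nx_def)

text \<open>
  By the recurrence, \<open>Dx\<close> vanishes at step \<open>m + 1\<close> only if \<open>u (m + 2) = u m\<close>, which would make
  \<open>tau (m + 6)\<close> divide the polynomial \<open>tau (m + 1)\<close> of smaller degree.
\<close>

lemma Dx_nz: "Dx (x n) (x (n + 1)) \<noteq> 0"
proof (cases n)
  case 0
  then show ?thesis
    using params_nz orbit_init F_DN(1)[symmetric] by simp
next
  case (Suc m)
  have "const3 h \<noteq> 0"
    using h by (simp add: const3_def)
  moreover have "Dx (x n) (x (n + 1)) = const3 h * (u n * (u n + 2 * u (n + 1) - (3 + const3 h)) + const3 h)"
    by (simp add: Dx_def x_def algebra_simps power2_eq_square)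
  moreover have "u (m + 1) * (u (m + 1) + 2 * u (m + 2) - (3 + const3 h)) + const3 h = u (m + 1) * (u (m + 2) - u m)"
  proof -
    have "u (m + 1) * (u (m + 2) + u (m + 1) + u m) = u (m + 1) * (3 + const3 h) - const3 h"
      unfolding u_rec using u_nz[of "m + 1"] by (simp add: algebra_simps)
    then show ?thesis
      by (simp add: algebra_simps)
  qed
  moreover have "u (m + 2) \<noteq> u m"
  proof
    assume "u (m + 2) = u m"
    then have "F (tau (m + 6) * (tau (m + 3) * tau (m + 3) * tau (m + 2)))
        = F (tau (m + 4) * (tau (m + 4) * tau (m + 5) * tau (m + 1)))"
      by (simp add: u_def field_simps numeral_eq_Suc)
    then have "tau (m + 6) dvd tau (m + 4) * (tau (m + 4) * tau (m + 5) * tau (m + 1))"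
      by (simp only: to_fract_eq_iff) (metis dvd_triv_left)
    moreover have "coprime (tau (m + 6)) (tau (m + 4))" "coprime (tau (m + 6)) (tau (m + 5))"
      using tau_coprime[of 2 "m + 4"] tau_coprime[of 1 "m + 5"] by (simp_all add: numeral_eq_Suc)
    ultimately have "tau (m + 6) dvd tau (m + 1)"
      by (simp add: coprime_dvd_mult_right_iff mult.assoc)
    then have "tau_degree (m + 6) \<le> tau_degree (m + 1)"
      using total_degree_dvd_le[of "tau (m + 6)" "tau (m + 1)"] by simp
    with tau_degree_less[of m] show False
      by simp
  qed
  ultimately show ?thesis
    using u_nz[of "m + 1"] by (simp add: Suc)
qed

text \<open>\<open>L\<close> is affine in its last argument with slope \<open>Dx\<close>, so
  \<open>L = const3 I2\<close> is the asserted formula. It holds initially by the choice of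
  \<open>W1\<close>, and the two recurrences preserve it.\<close>

lemma y_step: "y (n + 1) = Nx (x n) (y n) (x (n + 1)) / Dx (x n) (x (n + 1))"
proof -
  define L where "L = (\<lambda>x0 x1 x2 x3. 2*const3 h*x0 + x0\<^sup>2 - 2*const3 h*x0*x1 + 2*const3 h*x2 + x0*x2
    - const3 h*x1*x2 + (const3 h)\<^sup>2*x1*x2
    + 2*const3 h*x0*x1*x2 + x2\<^sup>2 + const3 h*x1*x2\<^sup>2 - const3 h*x0*x3 + (const3 h)\<^sup>2*x0*x3
    + const3 h*x0\<^sup>2*x3 - 2*const3 h*x2*x3 + 2*const3 h*x0*x2*x3)"
  have L: "L a b c d = const3 I2 \<longleftrightarrow> d = Nx a b c / Dx a c" if "Dx a c \<noteq> 0" for a b c d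
  proof -
    have "L a b c d - const3 I2 = d * Dx a c - Nx a b c"
      by (simp add: L_def Dx_def Nx_def algebra_simps power2_eq_square)
    then have "L a b c d = const3 I2 \<longleftrightarrow> d * Dx a c = Nx a b c"
      by (metis eq_iff_diff_eq_0)
    with that show ?thesis
      by (simp add: eq_divide_eq)
  qed
  have "L (x n) (y n) (x (n + 1)) (y (n + 1)) = const3 I2"
  proof (induction n)
    case 0
    show ?case
      using L[OF Dx_nz[of 0]] orbit_init F_DN by simp
  next
    case (Suc n)
    have "x (n + 1) \<noteq> 1"
      using u_nz[of "n + 1"] by (simp add: x_def)
    then have "L (x (n + 1)) (y (n + 1)) (x (n + 2)) (y (n + 2)) = L (x n) (y n) (x (n + 1)) (y (n + 1))"
      unfolding L_def by (rule I2_invariant[OF _ x_rec y_rec])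
    with Suc show ?case
      by simp
  qed
  then show ?thesis
    using L[OF Dx_nz] by simp
qed

section \<open>Iterates and composability\<close>

definition "P2 = (- px2 - px0) * (1 - px2) + pc h * px2"

lemma psi_eq: "psi h I2 = (F px2 / F 1, F N / F D, F P2 / F (1 - px2))"
proof -
  have "1 - px2 \<noteq> 0"
    using params_nz by (simp add: V_def)
  then have "1 - X2 \<noteq> 0"
    by (simp add: X_eq to_fract_1[symmetric] del: to_fract_1 flip: to_fract_diff)
  then show ?thesis
    unfolding F_DN psi_def Let_def
    by (simp add: Dx_def Nx_def P2_def X_eq[symmetric] const3_eq[symmetric] add_divide_distrib)
qed

text \<open>The denominators \<open>1\<close>, \<open>D\<close> and \<open>1 - px2\<close> become
  \<open>1\<close>, \<open>Dx (x n) (x (n + 1))\<close> and \<open>u (n + 1)\<close> on the orbit,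
  all nonzero.\<close>

lemma iterate_eq: "ratmap_iterate (psi h I2) n = (x n, y n, x (n + 1))"
  and composable_iterate: "composable (psi h I2) (x n, y n, x (n + 1))"
proof -
  have step: "composable (psi h I2) (x n, y n, x (n + 1)) \<and>
     ratmap_comp (psi h I2) (x n, y n, x (n + 1)) = (x (n + 1), y (n + 1), x (n + 2))" for n
  proof -
    let ?g = "(x n, y n, x (n + 1))"
    note e = eval3_eq is_hom_simps[OF is_hom_ev3[OF is_hom_const3]] ev3_gens[OF is_hom_const3]
    have 0: "substitutable (F px2 / F 1) ?g \<and> subst3 (F px2 / F 1) ?g = eval3 px2 ?g / eval3 1 ?g"
      by (rule subst3_quotient[OF refl]) (simp only: e, simp)
    have 1: "substitutable (F N / F D) ?g \<and> subst3 (F N / F D) ?g = eval3 N ?g / eval3 D ?g"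
      by (rule subst3_quotient[OF refl]) (simp only: eval_DN Dx_nz, simp)
    have u: "1 - x (n + 1) \<noteq> 0"
      using u_nz[of "n + 1"] by (simp add: x_def)
    have 2: "substitutable (F P2 / F (1 - px2)) ?g \<and>
      subst3 (F P2 / F (1 - px2)) ?g = eval3 P2 ?g / eval3 (1 - px2) ?g"
      by (rule subst3_quotient[OF refl]) (use u in \<open>simp only: e, simp\<close>)
    have "eval3 px2 ?g / eval3 1 ?g = x (n + 1)"
      by (simp only: e) simp
    moreover have "eval3 N ?g / eval3 D ?g = y (n + 1)"
      by (simp only: eval_DN y_step)
    moreover have "eval3 P2 ?g / eval3 (1 - px2) ?g = x (n + 2)"
      using u by (simp only: e P2_def x_rec) (simp add: add_divide_distrib)
    ultimately show ?thesis
      using 0 1 2 unfolding psi_eq by (simp only: composable.simps ratmap_comp.simps)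
  qed
  from step show "composable (psi h I2) (x n, y n, x (n + 1))"
    by blast
  show "ratmap_iterate (psi h I2) n = (x n, y n, x (n + 1))"
  proof (induction n)
    case 0
    then show ?case
      using orbit_init by simp
  next
    case (Suc n)
    then show ?case
      using step[of n] by (simp del: One_nat_def) simp
  qed
qed

section \<open>Degrees of the components\<close>

definition "p n = tau (n + 4) * tau (n + 1)"
definition "q n = tau (n + 3) * tau (n + 2)"

lemma q_nz: "q n \<noteq> 0"
  by (simp add: q_def)

lemma u_pq: "u n = F (p n) / F (q n)"
  by (simp add: u_def p_def q_def)

lemma total_degree_pq: "total_degree (p n) \<le> n * n + 1" "total_degree (q n) \<le> total_degree (p n)"
proof -
  have p: "total_degree (p n) = tau_degree (n + 4) + tau_degree (n + 1)"
    and q: "total_degree (q n) = tau_degree (n + 3) + tau_degree (n + 2)"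
    unfolding p_def q_def by (simp_all add: total_degree_mult)
  show "total_degree (q n) \<le> total_degree (p n)"
    unfolding p q using tau_degree_rec(2)[of n] by linarith
  show "total_degree (p n) \<le> n * n + 1"
    unfolding p using tau_degree_sum(2)[of n] le0[of "n * n"] by simp
qed

lemma degree_x_le: "ratfun_degree (x n) \<le> 2 * n * n + 4"
proof (rule ratfun_degree_le)
  show "x n = F (q n - p n) / F (q n)" "q n \<noteq> 0"
    using q_nz[of n] by (simp_all add: x_def u_def p_def q_def diff_divide_distrib)
  show "total_degree (q n - p n) \<le> 2 * n * n + 4" "total_degree (q n) \<le> 2 * n * n + 4"
    using total_degree_pq[of n] total_degree_diff_le[of "q n" "p n"] by linarith+
qed

text \<open>The four Somos terms of a quotient have indices at distance 1 or 2 across the fraction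
  bar, so they are coprime and the whole denominator, of degree \<open>n * (n + 1) / 2\<close>,
  remains.\<close>

lemma degree_x_ge: "n * n + n \<le> 2 * ratfun_degree (x (n + 1))"
proof -
  have "x (n + 1) = F (q (n + 1) - p (n + 1)) / F (q (n + 1))" "q (n + 1) \<noteq> 0"
    using q_nz[of "n + 1"] by (simp_all add: x_def u_def p_def q_def diff_divide_distrib)
  moreover have "coprime (q (n + 1) - p (n + 1)) (q (n + 1))"
  proof (rule coprimeI)
    fix r assume r: "r dvd q (n + 1) - p (n + 1)" "r dvd q (n + 1)"
    then have "r dvd q (n + 1) - (q (n + 1) - p (n + 1))"
      by (rule dvd_diff[rotated])
    then have "r dvd p (n + 1)"
      by simp
    moreover have "coprime (p (n + 1)) (q (n + 1))"
      using tau_coprime[of 1 "n + 4"] tau_coprime[of 2 "n + 3"] tau_coprime[of 1 "n + 2"] tau_coprime[of 2 "n + 2"]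
      by (simp add: p_def q_def numeral_eq_Suc coprime_commute)
    ultimately show "is_unit r"
      using r(2) by (metis coprime_common_divisor)
  qed
  ultimately have "total_degree (q (n + 1)) \<le> ratfun_degree (x (n + 1))"
    by (rule ratfun_degree_ge)
  moreover have "total_degree (q (n + 1)) = tau_degree (n + 4) + tau_degree (n + 3)"
    unfolding q_def by (simp add: total_degree_mult numeral_eq_Suc)
  ultimately show ?thesis
    unfolding tau_degree_sum(1)[symmetric] by simp
qed

text \<open>All summands share the denominator \<open>D * q n * q n\<close>, however many recurrence
  steps led to them. The derivatives \<open>p'\<close> and \<open>q'\<close> exceed
  \<open>p n\<close> by at most 2 in degree.\<close>

lemma degree_y_le: "ratfun_degree (y n) \<le> 2 * n * n + 4"
proof (rule ratfun_degree_le)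
  define p' where "p' = sigma (n + 4) * tau (n + 1) + tau (n + 4) * sigma (n + 1)"
  define q' where "q' = sigma (n + 3) * tau (n + 2) + tau (n + 3) * sigma (n + 2)"
  have D: "D \<noteq> 0"
    using params_nz by simp
  have w: "w n = (F p' * F (q n) - F (p n) * F q') / (F (q n))\<^sup>2 / F D"
    by (simp add: w_def p'_def q'_def p_def q_def)
  show "y n = F (- 2 * pc kappa * D * (q n * q n) - pc kappa * D * (p n * q n) + (p' * q n - p n * q')) / F (D * (q n * q n))"
    unfolding y_def w u_pq const3_eq is_hom_simps[OF is_hom_to_fract] using q_nz[of n] D
    by (simp add: field_simps power2_eq_square)
  show "D * (q n * q n) \<noteq> 0"
    using q_nz D by simp
  let ?P = "total_degree (p n)"
  have p': "total_degree p' \<le> ?P + 2"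
  proof -
    have "total_degree p' \<le> max ((tau_degree (n + 4) + 2) + tau_degree (n + 1))
        (tau_degree (n + 4) + (tau_degree (n + 1) + 2))"
      unfolding p'_def by (intro total_degree_le_ops total_degree_sigma) simp_all
    then show ?thesis
      by (simp add: p_def total_degree_mult)
  qed
  have q': "total_degree q' \<le> ?P + 2"
  proof -
    have "total_degree q' \<le> max ((tau_degree (n + 3) + 2) + tau_degree (n + 2))
        (tau_degree (n + 3) + (tau_degree (n + 2) + 2))"
      unfolding q'_def by (intro total_degree_le_ops total_degree_sigma) simp_all
    also have "\<dots> = total_degree (q n) + 2"
      by (simp add: q_def total_degree_mult)
    finally show ?thesis
      using total_degree_pq(2)[of n] by linarith
  qed
  note le = total_degree_le total_degree_D total_degree_pq(2)[of n] p' q' order.refl[of ?P]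
  have P: "2 * ?P + 2 \<le> 2 * n * n + 4"
    using total_degree_pq(1)[of n] by simp
  show "total_degree (D * (q n * q n)) \<le> 2 * n * n + 4"
    by (rule order.trans[OF _ P], rule order.trans, (rule le)+) simp
  show "total_degree (- 2 * pc kappa * D * (q n * q n) - pc kappa * D * (p n * q n) + (p' * q n - p n * q')) \<le> 2 * n * n + 4"
    by (rule order.trans[OF _ P], rule order.trans, (rule le)+) simp
qed

text \<open>The lower bound comes from the third component \<open>x (n + 1)\<close>.\<close>

lemma degree_iterate: "n * n \<le> 2 * ratmap_degree (ratmap_iterate (psi h I2) n)"
  "ratmap_degree (ratmap_iterate (psi h I2) n) \<le> 2 * (n + 1) * (n + 1) + 4"
proof -
  have deg: "ratmap_degree (ratmap_iterate (psi h I2) n)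
     = max (ratfun_degree (x n)) (max (ratfun_degree (y n)) (ratfun_degree (x (n + 1))))"
    unfolding iterate_eq by simp
  show "n * n \<le> 2 * ratmap_degree (ratmap_iterate (psi h I2) n)"
    unfolding deg using degree_x_ge[of n] by (simp add: max_def split: if_splits)
  have "2 * n * n + 4 \<le> 2 * (n + 1) * (n + 1) + 4"
    by simp
  with degree_x_le[of n] degree_y_le[of n] degree_x_le[of "n + 1"]
  show "ratmap_degree (ratmap_iterate (psi h I2) n) \<le> 2 * (n + 1) * (n + 1) + 4"
    unfolding deg by linarith
qed

end

section \<open>Quadratic growth\<close>

theorem corollary2p3:
  fixes h I2 :: complex
  assumes "h \<noteq> 0"
  shows "(\<forall>n. composable (psi h I2) (ratmap_iterate (psi h I2) n)) \<and>
    (\<lambda>n. real (ratmap_degree (ratmap_iterate (psi h I2) n))) \<in> \<Theta>(\<lambda>n. (real n)\<^sup>2)"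
proof
  interpret psi_orbit h I2
    by unfold_locales (rule assms)
  let ?d = "\<lambda>n. ratmap_degree (ratmap_iterate (psi h I2) n)"
  show "\<forall>n. composable (psi h I2) (ratmap_iterate (psi h I2) n)"
    using composable_iterate by (simp only: iterate_eq) blast
  show "(\<lambda>n. real (?d n)) \<in> \<Theta>(\<lambda>n. (real n)\<^sup>2)"
  proof (rule bigthetaI)
    show "(\<lambda>n. real (?d n)) \<in> O(\<lambda>n. (real n)\<^sup>2)"
    \<comment> \<open>For \<open>n \<ge> 1\<close>, \<open>n + 1 \<le> 2 * n\<close> bounds the
      degree by \<open>8 * n * n + 4 * n * n\<close>, whence the constant 12.\<close>
    proof (rule bigoI[of _ 12], rule eventually_mono[OF eventually_ge_at_top[of 1]])
      fix n :: nat assume n: "n \<ge> 1"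
      then have "2 * (n + 1) * (n + 1) + 4 \<le> 2 * (2 * n) * (2 * n) + 4 * (n * n)"
        by (intro add_mono mult_mono) auto
      with degree_iterate(2)[of n] have "?d n \<le> 12 * (n * n)"
        by simp
      then have "real (?d n) \<le> real (12 * (n * n))"
        by (rule of_nat_mono)
      then show "norm (real (?d n)) \<le> 12 * norm ((real n)\<^sup>2)"
        by (simp add: power2_eq_square)
    qed
    show "(\<lambda>n. real (?d n)) \<in> \<Omega>(\<lambda>n. (real n)\<^sup>2)"
    proof (rule landau_omega.bigI[of "1 / 2"])
      have "real (n * n) \<le> real (2 * ?d n)" for n
        using degree_iterate(1)[of n] by (rule of_nat_mono)
      then show "\<forall>\<^sub>F n in at_top. norm (real (?d n)) \<ge> 1 / 2 * norm ((real n)\<^sup>2)"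
        by (simp add: power2_eq_square mult.commute)
    qed simp
  qed
qed

end
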